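(* Let $p,q>0$, let $w_{p,q}$ be the weighting function defined in the context, and $A_N^{p,q}=\sum_{n=0}^{N-1}w_{p,q}(n/N)$. Let $(\mathscr B,\|\cdot\|_{\mathscr B})$ be a Banach space. (i) (Discrete case.) Let $\{a_n\}_{n=1}^\infty$ be a sequence in $\mathscr B$ and $a\in\mathscr B$ such that $\frac1N\sum_{n=1}^N a_n\to a$ in $\|\cdot\|_{\mathscr B}$ as $N\to+\infty$. Then $$\frac{1}{A_N^{p,q}}\sum_{n=1}^{N} w_{p,q}(n/N)\,a_n\to a\quad\text{in }\|\cdot\|_{\mathscr B}\text{ as }N\to+\infty .$$ (ii) (Continuous case.) Let $a:[0,+\infty)\to\mathscr B$ be locally (Bochner) integrable and let $a_*\in\mathscr B$ be such that $\frac1N\int_0^N a(s)\,ds\to a_*$ in $\|\cdot\|_{\mathscr B}$ as $N\to+\infty$. Then $\frac1N\int_0^N w_{p,q}(s/N)\,a(s)\,ds\to a_*$ in $\|\cdot\|_{\mathscr B}$ as $N\to+\infty$. (iii) The converse is not true: there exist a Banach space $\mathscr B$, a sequence $\{a_n\}_{n=1}^\infty$ in $\mathscr B$ and $a\in\mathscr B$ such that $\frac{1}{A_N^{p,q}}\sum_{n=1}^{N} w_{p,q}(n/N)a_n\to a$ in norm as $N\to+\infty$, but $\frac1N\sum_{n=1}^N a_n$ does not converge to $a$ in norm. (iv) The statements (i), (ii), (iii) remain true when $w_{p,q}$ is replaced by an arbitrary weighting function $w\in C_0^1([0,1])$ with $\int_0^1 w(x)\,dx=1$, and $A_N^{p,q}$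 is replaced by $A_N=\sum_{n=0}^{N-1}w(n/N)$ ($N$ large enough that $A_N\neq0$).
   Context: For $p,q>0$, $w_{p,q}:\mathbb R\to\mathbb R$ is defined by $$w_{p,q}(x)=\Big(\int_0^1\exp(-s^{-p}(1-s)^{-q})\,ds\Big)^{-1}\exp\big(-x^{-p}(1-x)^{-q}\big)\ \text{ for }x\in(0,1),\qquad w_{p,q}(x)=0\ \text{ for }x\notin(0,1).$$ It is a $C^\infty$ function supported in $[0,1]$ with $\int_0^1 w_{p,q}=1$. $N$ is taken at least $2$, so that $A_N^{p,q}>0$. $C_0^1([0,1])$ denotes the $C^1$ functions on $\mathbb R$ supported in $[0,1]$ (so the function and its first derivative vanish at $0$ and $1$). *)

theory Defs
  imports "HOL-Analysis.Analysis"
begin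

text \<open>
  The library's Bochner integral is restricted to second-countable value spaces.  The following
  three definitions repeat the library's definitions word for word for an arbitrary (possibly
  non-separable) normed space; the lemmas record that nothing else has changed.
\<close>

definition has_bochner_int :: "'a measure \<Rightarrow> ('a \<Rightarrow> 'b::real_normed_vector) \<Rightarrow> 'b \<Rightarrow> bool" where
  "has_bochner_int M f x \<longleftrightarrow>
     f \<in> borel_measurable M \<and>
     (\<exists>s. (\<forall>i. Bochner_Integration.simple_bochner_integrable M (s i)) \<and>
          (\<lambda>i. \<integral>\<^sup>+y. norm (f y - s i y) \<partial>M) \<longlonglongrightarrow> 0 \<and>
          (\<lambda>i. Bochner_Integration.simple_bochner_integral M (s i)) \<longlonglongrightarrow> x)"

definition bochner_integrable :: "'a measure \<Rightarrow> ('a \<Rightarrow> 'b::real_normed_vector) \<Rightarrow> bool" where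
  "bochner_integrable M f \<longleftrightarrow> (\<exists>x. has_bochner_int M f x)"

definition bochner_int :: "'a measure \<Rightarrow> ('a \<Rightarrow> 'b::real_normed_vector) \<Rightarrow> 'b" where
  "bochner_int M f =
     (if \<exists>x. has_bochner_int M f x then THE x. has_bochner_int M f x else 0)"

lemma has_bochner_int_eq_library:
  fixes f :: "'a \<Rightarrow> 'b::{real_normed_vector, second_countable_topology}"
  shows "has_bochner_int M f x \<longleftrightarrow> has_bochner_integral M f x"
  unfolding has_bochner_int_def has_bochner_integral.simps by blast

lemma bochner_integrable_eq_library:
  fixes f :: "'a \<Rightarrow> 'b::{banach, second_countable_topology}"
  shows "bochner_integrable M f \<longleftrightarrow> integrable M f"
  unfolding bochner_integrable_def has_bochner_int_eq_library integrable.simps by simp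

lemma bochner_int_eq_library:
  fixes f :: "'a \<Rightarrow> 'b::{banach, second_countable_topology}"
  shows "bochner_int M f = integral\<^sup>L M f"
  unfolding bochner_int_def lebesgue_integral_def has_bochner_int_eq_library ..

text \<open>Only the values of \<open>a\<close> on the half-line \<open>[0, \<infinity>)\<close> matter here.\<close>

definition locally_bochner_integrable :: "(real \<Rightarrow> 'b::real_normed_vector) \<Rightarrow> bool" where
  "locally_bochner_integrable a \<longleftrightarrow> (\<forall>R\<ge>0. bochner_integrable (lebesgue_on {0..R}) a)"

definition w_pq :: "real \<Rightarrow> real \<Rightarrow> real \<Rightarrow> real" where
  "w_pq p q x =
     (if x \<in> {0<..<1}
      then inverse (LBINT s:{0<..<1}. exp (- (s powr (-p) * (1 - s) powr (-q))))
           * exp (- (x powr (-p) * (1 - x) powr (-q)))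
      else 0)"

definition C01 :: "(real \<Rightarrow> real) set" where
  "C01 = {w. w C1_differentiable_on UNIV \<and> (\<forall>x. x \<notin> {0..1} \<longrightarrow> w x = 0)}"

definition weight_sum :: "(real \<Rightarrow> real) \<Rightarrow> nat \<Rightarrow> real" where
  "weight_sum w N = (\<Sum>n = 0..<N. w (real n / real N))"

text \<open>
  Sequences are indexed from 1, so \<open>a 0\<close> is never used.  For a weight of integral 1,
  \<open>weight_sum w N = 0\<close> holds for finitely many \<open>N\<close> only; there the weighted average takes the
  irrelevant value 0.
\<close>

definition average :: "(nat \<Rightarrow> 'b::real_normed_vector) \<Rightarrow> nat \<Rightarrow> 'b" where
  "average a N = (1 / real N) *\<^sub>R (\<Sum>n = 1..N. a n)"

definition weighted_average ::
    "(real \<Rightarrow> real) \<Rightarrow> (nat \<Rightarrow> 'b::real_normed_vector) \<Rightarrow> nat \<Rightarrow> 'b" where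
  "weighted_average w a N =
     (1 / weight_sum w N) *\<^sub>R (\<Sum>n = 1..N. w (real n / real N) *\<^sub>R a n)"

text \<open>
  In continuous time the averaging length \<open>N\<close> is a real number tending to infinity.  (With \<open>N\<close>
  restricted to integers, the unweighted averages would not control the weighted ones.)
\<close>

definition average_cont :: "(real \<Rightarrow> 'b::real_normed_vector) \<Rightarrow> real \<Rightarrow> 'b" where
  "average_cont a N = (1 / N) *\<^sub>R bochner_int (lebesgue_on {0..N}) a"

definition weighted_average_cont ::
    "(real \<Rightarrow> real) \<Rightarrow> (real \<Rightarrow> 'b::real_normed_vector) \<Rightarrow> real \<Rightarrow> 'b" where
  "weighted_average_cont w a N =
     (1 / N) *\<^sub>R bochner_int (lebesgue_on {0..N}) (\<lambda>s. w (s / N) *\<^sub>R a s)"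

end

theory Submission
  imports Defs
begin

text \<open>
  Everything rests on summation by parts.  Let the weight \<open>w\<close> be Lipschitz with constant \<open>L\<close>, zero
  outside the open unit interval, and of integral \<open>1\<close>.  Moving the differences from the partial
  sums \<open>S\<^sub>n = b\<^sub>1 + \<dots> + b\<^sub>n\<close> to the weight gives
  \<open>\<parallel>\<Sum>\<^sub>n w(n/N) b\<^sub>n\<parallel> \<le> L/N * \<Sum>\<^sub>n \<parallel>S\<^sub>n\<parallel>\<close>, the boundary term vanishing because \<open>w 1 = 0\<close>.
  For \<open>b = a - l\<close>, convergence of the averages of \<open>a\<close> to \<open>l\<close> says that \<open>S\<^sub>n = o(n)\<close>, so that
  the right-hand side is \<open>o(N)\<close>; since \<open>weight_sum w N / N\<close> is a Riemann sum tending to \<open>1\<close>, the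
  weighted averages converge to \<open>l\<close>.

  The same bound produces the counterexample to the converse.  It asks only that the \<open>S\<^sub>n\<close> be
  \<open>o(n)\<close> in the mean: let \<open>S\<^sub>n = n\<close> at the perfect squares and \<open>S\<^sub>n = 0\<close> elsewhere.  The
  averages \<open>S\<^sub>n / n\<close> then return to \<open>1\<close> for ever, while the weighted averages tend to \<open>0\<close>.

  In continuous time the bound reads
  \<open>\<parallel>\<integral>\<^sub>0\<^sup>N w(s/N) b(s) ds\<parallel> \<le> L * sup\<^sub>t \<parallel>\<integral>\<^sub>0\<^sup>t b\<parallel>\<close>, and the supremum is \<open>o(N)\<close>.  As the
  value space may be non-separable, the Bochner integral is first turned into a
  Henstock-Kurzweil integral, for which linearity, additivity over intervals and norm bounds hold
  in any Banach space (\<open>has_bochner_int_has_integral\<close>); the product of a Bochner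
  integrable function and a bounded measurable one is shown to be Bochner integrable
  (\<open>bochner_integrable_scaleR\<close>), so that the weighted integrals are meaningful.

  Finally \<open>w_pq p q\<close> and the weights in \<open>C01\<close> of integral \<open>1\<close> have the three properties.  For
  \<open>w_pq\<close> this is where the exponential beats every power of its exponent near \<open>0\<close> and \<open>1\<close>.
\<close>

section \<open>Lipschitz weights\<close>

text \<open>
  The common properties of \<open>w_pq p q\<close> and of the weights in \<open>C01\<close> on which all parts of the
  theorem rest.  The weight vanishes at the end points as well, which removes the boundary term
  in summation by parts.
\<close>

locale lipschitz_weight =
  fixes w :: "real \<Rightarrow> real" and L :: real
  assumes lipschitz: "L-lipschitz_on UNIV w"
    and zero_outside: "x \<notin> {0<..<1} \<Longrightarrow> w x = 0"
    and integral_one: "(w has_integral 1) {0..1}"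
begin

lemma lipschitz_bound: "\<bar>w x - w y\<bar> \<le> L * \<bar>x - y\<bar>"
  using lipschitz_onD[OF lipschitz, of x y] by (simp add: dist_real_def)

lemma L_nonneg: "0 \<le> L"
  using lipschitz by (rule lipschitz_on_nonneg)

lemma continuous: "continuous_on A w"
  using lipschitz_on_continuous_on[OF lipschitz] continuous_on_subset by blast

lemma zero_at_ends [simp]: "w 0 = 0" "w 1 = 0"
  by (simp_all add: zero_outside)

end

section \<open>Averages of sequences\<close>

lemma summation_by_parts:
  fixes b :: "nat \<Rightarrow> 'b::real_vector"
  shows "(\<Sum>n=1..m. \<phi> n *\<^sub>R b n)
    = \<phi> m *\<^sub>R (\<Sum>k=1..m. b k) - (\<Sum>n<m. (\<phi> (Suc n) - \<phi> n) *\<^sub>R (\<Sum>k=1..n. b k))"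
  by (induction m) (simp_all add: algebra_simps)

text \<open>
  A bound of the form \<open>S n \<le> C + \<epsilon> n\<close> holds for all \<open>n\<close> at once, with the finitely many terms
  before the asymptotic regime absorbed into \<open>C\<close>.
\<close>

lemma sublinear_affine_bound:
  fixes S :: "nat \<Rightarrow> real"
  assumes "(\<lambda>n. S n / real n) \<longlonglongrightarrow> 0" and "\<epsilon> > 0"
  obtains C where "\<And>n. S n \<le> C + \<epsilon> * real n"
proof -
  obtain n0 where n0: "\<And>n. n \<ge> n0 \<Longrightarrow> S n / real n < \<epsilon>"
    using order_tendstoD(2)[OF assms] by (auto simp: eventually_sequentially)
  define C where "C = Max (insert 0 (S ` {..max 1 n0}))"
  have C: "x \<le> C" if "x \<in> insert 0 (S ` {..max 1 n0})" for x
    unfolding C_def using that by (intro Max_ge) simp_all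
  have "S n \<le> C + \<epsilon> * real n" for n
  proof (cases "n \<le> max 1 n0")
    case True
    then have "S n \<le> C" by (intro C) blast
    moreover have "0 \<le> \<epsilon> * real n" using \<open>\<epsilon> > 0\<close> by simp
    ultimately show ?thesis by linarith
  next
    case False
    then have "S n < \<epsilon> * real n" using n0[of n] by (simp add: field_simps)
    then show ?thesis using C[of 0] by simp
  qed
  then show thesis by (rule that)
qed

lemma mean_of_sublinear:
  fixes S :: "nat \<Rightarrow> real"
  assumes nonneg: "\<And>n. 0 \<le> S n" and lim: "(\<lambda>n. S n / real n) \<longlonglongrightarrow> 0"
  shows "(\<lambda>N. (\<Sum>n<N. S n) / (real N)\<^sup>2) \<longlonglongrightarrow> 0"
proof (rule LIMSEQ_I)
  fix r :: real assume "r > 0"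
  obtain C where C: "\<And>n. S n \<le> C + (r/2) * real n"
    using sublinear_affine_bound[OF lim, of "r/2"] \<open>r > 0\<close> by auto
  have "eventually (\<lambda>N. real N > 2 * C / r) sequentially"
    by (rule eventually_gt_at_top[THEN filterlim_real_sequentially[unfolded filterlim_iff, rule_format]])
  then obtain N0 where N0: "\<And>N. N \<ge> N0 \<Longrightarrow> real N > 2 * C / r"
    by (auto simp: eventually_sequentially)
  show "\<exists>no. \<forall>n\<ge>no. norm ((\<Sum>n<n. S n) / (real n)\<^sup>2 - 0) < r"
  proof (intro exI allI impI)
    fix N assume "N \<ge> max 1 N0"
    then have N: "real N > 0" "C < (r/2) * real N"
      using N0[of N] \<open>r > 0\<close> by (auto simp: field_simps)
    have "(\<Sum>n<N. S n) \<le> (\<Sum>n<N. C + (r/2) * real N)"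
    proof (rule sum_mono)
      fix n assume "n \<in> {..<N}"
      then have "(r/2) * real n \<le> (r/2) * real N"
        using \<open>r > 0\<close> by (intro mult_left_mono) auto
      then show "S n \<le> C + (r/2) * real N" using C[of n] by linarith
    qed
    also have "\<dots> = real N * (C + (r/2) * real N)" by simp
    also have "\<dots> < real N * (r * real N)"
      using N by (intro mult_strict_left_mono) auto
    finally have "(\<Sum>n<N. S n) / (real N)\<^sup>2 < r"
      using N by (simp add: field_simps power2_eq_square)
    moreover have "(\<Sum>n<N. S n) / (real N)\<^sup>2 \<ge> 0" using nonneg by (simp add: sum_nonneg)
    ultimately show "norm ((\<Sum>n<N. S n) / (real N)\<^sup>2 - 0) < r" by simp
  qed
qed

context lipschitz_weight
begin

text \<open>
  Summation by parts; consecutive weights differ by at most \<open>L / N\<close>, and the boundary term carries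
  the factor \<open>w 1 = 0\<close>.
\<close>

lemma weighted_sum_bound:
  fixes b :: "nat \<Rightarrow> 'b::real_normed_vector"
  shows "norm (\<Sum>n=1..N. w (real n / real N) *\<^sub>R b n)
    \<le> L / real N * (\<Sum>n<N. norm (\<Sum>k=1..n. b k))"
proof -
  let ?S = "\<lambda>n. \<Sum>k=1..n. b k"
  have "w (real N / real N) = 0" by (cases "N = 0") auto
  then have "(\<Sum>n=1..N. w (real n / real N) *\<^sub>R b n)
      = - (\<Sum>n<N. (w (real (Suc n) / real N) - w (real n / real N)) *\<^sub>R ?S n)"
    using summation_by_parts[of "\<lambda>n. w (real n / real N)" b N] by simp
  also have "norm \<dots> \<le> (\<Sum>n<N. L / real N * norm (?S n))"
    unfolding norm_minus_cancel
  proof (rule sum_norm_le)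
    fix n assume "n \<in> {..<N}"
    have "\<bar>w (real (Suc n) / real N) - w (real n / real N)\<bar> \<le> L / real N"
      using lipschitz_bound[of "real (Suc n) / real N" "real n / real N"]
      by (simp add: diff_divide_distrib[symmetric])
    then show "norm ((w (real (Suc n) / real N) - w (real n / real N)) *\<^sub>R ?S n)
        \<le> L / real N * norm (?S n)"
      unfolding norm_scaleR real_norm_def by (rule mult_right_mono) simp
  qed
  finally show ?thesis by (simp add: sum_distrib_left)
qed

text \<open>
  Over each of the \<open>N\<close> cells, of length \<open>h = 1 / N\<close>, a Lipschitz function differs from its
  value at the left end by at most \<open>L h\<close>; the errors \<open>L h\<^sup>2\<close> add up to \<open>L h\<close>.
\<close>

lemma riemann_sum_error:
  assumes "N > 0"
  shows "\<bar>1 - weight_sum w N / real N\<bar> \<le> L / real N"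
proof -
  define h where "h = 1 / real N"
  have h: "h > 0" "real N * h = 1" using assms by (auto simp: h_def)
  have int: "w integrable_on {u..v}" for u v
    by (intro integrable_continuous_real continuous)
  \<comment> \<open>The cell integrals are written as increments of \<open>G\<close>, so that they telescope to \<open>G 1 - G 0 = 1\<close>.\<close>
  define G where "G u = integral {0..u} w" for u
  have step: "\<bar>G (real (Suc n) * h) - G (real n * h) - h * w (real n * h)\<bar> \<le> L * h * h" for n
  proof -
    let ?u = "real n * h" and ?v = "real (Suc n) * h"
    have uv: "0 \<le> ?u" "?u \<le> ?v" "?v - ?u = h" using h by (auto simp: algebra_simps)
    have "integral {?u..?v} (\<lambda>s. w s - w ?u) = integral {?u..?v} w - h * w ?u"
      using uv by (subst Henstock_Kurzweil_Integration.integral_diff) (auto intro: int)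
    then have "G ?v - G ?u - h * w ?u = integral {?u..?v} (\<lambda>s. w s - w ?u)"
      using Henstock_Kurzweil_Integration.integral_combine[OF uv(1,2) int]
      by (simp add: G_def)
    also have "norm \<dots> \<le> integral {?u..?v} (\<lambda>s. L * h)"
    proof (rule Henstock_Kurzweil_Integration.integral_norm_bound_integral)
      fix s assume "s \<in> {?u..?v}"
      then have "\<bar>s - ?u\<bar> \<le> h" using uv by auto
      then show "norm (w s - w ?u) \<le> L * h"
        using lipschitz_bound[of s ?u] mult_left_mono[OF _ L_nonneg] by fastforce
    qed (auto intro!: integrable_diff int)
    also have "\<dots> = L * h * h" using uv by simp
    finally show ?thesis by simp
  qed
  have "1 = G (real N * h) - G (real 0 * h)"
    using h integral_one by (simp add: G_def integral_unique)
  also have "\<dots> = (\<Sum>n<N. G (real (Suc n) * h) - G (real n * h))"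
    by (rule sum_lessThan_telescope[symmetric])
  finally have "1 - weight_sum w N / real N
      = (\<Sum>n<N. G (real (Suc n) * h) - G (real n * h) - h * w (real n * h))"
    by (simp add: sum_subtractf weight_sum_def h_def sum_divide_distrib atLeast0LessThan)
  also have "\<bar>\<dots>\<bar> \<le> (\<Sum>n<N. L * h * h)"
    using step by (intro order_trans[OF sum_abs] sum_mono) auto
  also have "\<dots> = L * h * (real N * h)" by simp
  finally show ?thesis using h by (simp add: h_def)
qed

lemma weight_sum_asymptotic: "(\<lambda>N. weight_sum w N / real N) \<longlonglongrightarrow> 1"
proof -
  have "(\<lambda>N. L / real N) \<longlonglongrightarrow> 0" by (rule lim_const_over_n)
  then have "(\<lambda>N. 1 - weight_sum w N / real N) \<longlonglongrightarrow> 0"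
    by (rule Lim_null_comparison[rotated])
      (use riemann_sum_error in \<open>auto intro!: eventually_mono[OF eventually_gt_at_top[of 0]]\<close>)
  from tendsto_diff[OF tendsto_const[of 1] this] show ?thesis by simp
qed

text \<open>
  The normalising sum runs over \<open>0, \<dots>, N - 1\<close> and the weighted sum over \<open>1, \<dots>, N\<close>; the two ranges
  differ only in indices at which the weight is zero.
\<close>

lemma weight_sum_shift: "(\<Sum>n=1..N. w (real n / real N)) = weight_sum w N"
proof (cases "N = 0")
  case False
  have "(\<Sum>n=1..N. w (real n / real N)) = (\<Sum>n\<in>{1..<N}. w (real n / real N))"
    using False by (intro sum.mono_neutral_right) auto
  also have "\<dots> = weight_sum w N"
    unfolding weight_sum_def using False by (intro sum.mono_neutral_left) (auto simp: not_le)
  finally show ?thesis .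
qed (simp add: weight_sum_def)

text \<open>
  The sufficient condition asks for smallness of the centred partial sums only in the mean.  This
  is weaker than convergence of the averages, and the gap is what the counterexample
  to the converse uses.
\<close>

lemma weighted_average_tendsto:
  fixes a :: "nat \<Rightarrow> 'b::real_normed_vector"
  assumes "(\<lambda>N. (\<Sum>n<N. norm (\<Sum>k=1..n. a k - l)) / (real N)\<^sup>2) \<longlonglongrightarrow> 0"
  shows "weighted_average w a \<longlonglongrightarrow> l"
proof -
  define r where "r N = weight_sum w N / real N" for N
  define x where "x N = (1 / real N) *\<^sub>R (\<Sum>n=1..N. w (real n / real N) *\<^sub>R (a n - l))" for N
  have r: "r \<longlonglongrightarrow> 1" unfolding r_def by (rule weight_sum_asymptotic)
  \<comment> \<open>After centring at \<open>l\<close>, the average is \<open>x N / r N + l\<close> with \<open>r N \<rightarrow> 1\<close>, so \<open>x \<rightarrow> 0\<close> suffices.\<close>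
  have "x \<longlonglongrightarrow> 0"
  proof (rule Lim_null_comparison)
    show "(\<lambda>N. L * ((\<Sum>n<N. norm (\<Sum>k=1..n. a k - l)) / (real N)\<^sup>2)) \<longlonglongrightarrow> 0"
      using tendsto_mult_right_zero[OF assms] .
    have "norm (x N) \<le> (1 / real N) * (L / real N * (\<Sum>n<N. norm (\<Sum>k=1..n. a k - l)))" for N
      unfolding x_def norm_scaleR
      by (rule mult_mono) (use weighted_sum_bound[of N "\<lambda>k. a k - l"] in auto)
    then show "\<forall>\<^sub>F N in sequentially. norm (x N)
        \<le> L * ((\<Sum>n<N. norm (\<Sum>k=1..n. a k - l)) / (real N)\<^sup>2)"
      by (intro always_eventually) (simp add: power2_eq_square)
  qed
  then have "(\<lambda>N. inverse (r N) *\<^sub>R x N + l) \<longlonglongrightarrow> inverse 1 *\<^sub>R 0 + l"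
    using r by (intro tendsto_intros) auto
  then have "(\<lambda>N. inverse (r N) *\<^sub>R x N + l) \<longlonglongrightarrow> l" by simp
  moreover have "\<forall>\<^sub>F N in sequentially. inverse (r N) *\<^sub>R x N + l = weighted_average w a N"
    using order_tendstoD(1)[OF r zero_less_one] eventually_gt_at_top[of 0]
  proof eventually_elim
    case (elim N)
    then have nz: "weight_sum w N \<noteq> 0" by (auto simp: r_def)
    have "inverse (r N) *\<^sub>R x N
        = (1 / weight_sum w N) *\<^sub>R (\<Sum>n=1..N. w (real n / real N) *\<^sub>R (a n - l))"
      using elim by (simp add: r_def x_def)
    also have "\<dots> = weighted_average w a N - l"
      using nz unfolding weighted_average_def scaleR_diff_right sum_subtractf
        scaleR_sum_left[symmetric] weight_sum_shift
      by simp
    finally show ?case by simp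
  qed
  ultimately show ?thesis by (rule Lim_transform_eventually)
qed

proposition weighted_average_of_convergent_average:
  fixes a :: "nat \<Rightarrow> 'b::real_normed_vector"
  assumes "average a \<longlonglongrightarrow> l"
  shows "weighted_average w a \<longlonglongrightarrow> l"
proof (intro weighted_average_tendsto mean_of_sublinear)
  have "(\<lambda>n. norm (average a n - l)) \<longlonglongrightarrow> 0"
    using assms by (simp add: LIM_zero tendsto_norm_zero)
  moreover have "\<forall>\<^sub>F n in sequentially.
      norm (average a n - l) = norm (\<Sum>k=1..n. a k - l) / real n"
    using eventually_gt_at_top[of 0]
  proof eventually_elim
    case (elim n)
    have "average a n - l = (1 / real n) *\<^sub>R (\<Sum>k=1..n. a k - l)"
      using elim by (simp add: average_def sum_subtractf scaleR_diff_right sum_constant_scaleR)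
    then show ?case by simp
  qed
  ultimately show "(\<lambda>n. norm (\<Sum>k=1..n. a k - l) / real n) \<longlonglongrightarrow> 0"
    by (rule Lim_transform_eventually)
qed simp

end

section \<open>Failure of the converse\<close>

text \<open>
  The partial sums of the counterexample.  Any infinite set of density zero could take the place
  of the squares: density zero makes the partial sums small in the mean, infinity keeps the
  averages from converging to zero.
\<close>

definition square_partial_sum :: "nat \<Rightarrow> real" where
  "square_partial_sum n = (if \<exists>m. n = m\<^sup>2 then real n else 0)"

text \<open>
  At most \<open>sqrt N + 1\<close> squares lie below \<open>N\<close>, and each contributes at most \<open>N\<close>.
\<close>

lemma square_partial_sum_mean:
  "(\<lambda>N. (\<Sum>n<N. \<bar>square_partial_sum n\<bar>) / (real N)\<^sup>2) \<longlonglongrightarrow> 0"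
proof (rule Lim_null_comparison)
  have "(\<Sum>n<N. \<bar>square_partial_sum n\<bar>) / (real N)\<^sup>2 \<le> (sqrt N + 1) / real N" for N
  proof (cases "N = 0")
    case False
    let ?Q = "{n. n < N \<and> (\<exists>m. n = m\<^sup>2)}"
    have Q: "?Q \<subseteq> (\<lambda>m. m\<^sup>2) ` {..nat \<lfloor>sqrt N\<rfloor>}"
    proof safe
      fix m :: nat assume "m\<^sup>2 < N"
      then have "(real m)\<^sup>2 \<le> real N" using of_nat_mono[of "m\<^sup>2" N, where 'a = real] by simp
      then have "real m \<le> sqrt N" by (rule real_le_rsqrt)
      then show "m\<^sup>2 \<in> (\<lambda>m. m\<^sup>2) ` {..nat \<lfloor>sqrt N\<rfloor>}" by (intro imageI) (simp add: le_nat_floor)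
    qed
    have "card ?Q \<le> Suc (nat \<lfloor>sqrt N\<rfloor>)"
      by (rule order_trans[OF card_mono[OF _ Q]]) (auto intro: order_trans[OF card_image_le])
    then have "real (card ?Q) \<le> real (nat \<lfloor>sqrt N\<rfloor>) + 1"
      by linarith
    also have "\<dots> \<le> sqrt N + 1"
      using of_nat_floor[of "sqrt N"] by simp
    finally have card: "real (card ?Q) \<le> sqrt N + 1" .
    have "(\<Sum>n<N. \<bar>square_partial_sum n\<bar>) \<le> (\<Sum>n<N. if \<exists>m. n = m\<^sup>2 then real N else 0)"
      by (intro sum_mono) (auto simp: square_partial_sum_def)
    also have "\<dots> = real (card ?Q) * real N"
      by (simp add: sum.If_cases Int_def)
    finally have "(\<Sum>n<N. \<bar>square_partial_sum n\<bar>) \<le> (sqrt N + 1) * real N"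
      using mult_right_mono[OF card, of "real N"] by linarith
    then show ?thesis using False by (simp add: field_simps power2_eq_square)
  qed simp
  then show "\<forall>\<^sub>F N in sequentially. norm ((\<Sum>n<N. \<bar>square_partial_sum n\<bar>) / (real N)\<^sup>2)
      \<le> (sqrt N + 1) / real N"
    by (intro always_eventually) (simp add: sum_nonneg)
  show "(\<lambda>N. (sqrt (real N) + 1) / real N) \<longlonglongrightarrow> 0"
  proof -
    have "(\<lambda>N. 1 / sqrt (real N) + 1 / real N) \<longlonglongrightarrow> 0 + 0"
      by (intro tendsto_add lim_const_over_n tendsto_divide_0[OF tendsto_const]
          filterlim_at_top_imp_at_infinity filterlim_compose[OF sqrt_at_top filterlim_real_sequentially])
    moreover have "(sqrt (real N) + 1) / real N = 1 / sqrt (real N) + 1 / real N" for N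
      by (simp add: add_divide_distrib sqrt_divide_self_eq inverse_eq_divide)
    ultimately show ?thesis by simp
  qed
qed

context lipschitz_weight
begin

proposition weighted_average_converse_fails:
  "\<exists>(a :: nat \<Rightarrow> real) l. weighted_average w a \<longlonglongrightarrow> l \<and> \<not> average a \<longlonglongrightarrow> l"
proof (intro exI conjI notI)
  define a where "a n = square_partial_sum n - square_partial_sum (n - 1)" for n
  have S: "(\<Sum>k=1..n. a k) = square_partial_sum n" for n
    by (induction n) (auto simp: a_def square_partial_sum_def)
  show "weighted_average w a \<longlonglongrightarrow> 0"
    by (rule weighted_average_tendsto) (simp only: diff_zero S real_norm_def square_partial_sum_mean)
  assume "average a \<longlonglongrightarrow> 0"
  then have "(\<lambda>m. average a ((Suc m)\<^sup>2)) \<longlonglongrightarrow> 0"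
    by (rule filterlim_compose)
      (auto intro!: filterlim_subseq strict_monoI power_strict_mono)
  moreover have "average a ((Suc m)\<^sup>2) = 1" for m
    unfolding average_def S by (auto simp: square_partial_sum_def)
  ultimately show False by (simp add: LIMSEQ_const_iff)
qed

end

section \<open>Measurability and integration without separability\<close>

text \<open>
  In a non-separable space the difference of two measurable functions need not be measurable.
  Combining a measurable function with a simple one is harmless, since on each of finitely many
  measurable pieces the simple function is a constant.
\<close>

lemma measurable_compose_simple:
  assumes g: "simple_function M g" and f: "\<And>c. f c \<in> measurable M N"
  shows "(\<lambda>x. f (g x) x) \<in> measurable M N"
proof (rule measurable_compose_countable'[where I = "g ` space M"])
  show "countable (g ` space M)"
    using simple_functionD(1)[OF g] by (rule countable_finite)
  show "g \<in> measurable M (count_space (g ` space M))"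
    using g by (auto simp: simple_function_def intro!: measurable_count_space_eq2[THEN iffD2])
qed (rule f)

lemma borel_measurable_norm_diff_simple:
  fixes f :: "'a \<Rightarrow> 'b::real_normed_vector"
  assumes [measurable]: "f \<in> borel_measurable M" and s: "simple_function M s"
  shows "(\<lambda>x. norm (f x - s x)) \<in> borel_measurable M"
proof (rule measurable_compose_simple[OF s])
  have "continuous_on UNIV (\<lambda>y. norm (y - c))" for c :: 'b by (intro continuous_intros)
  then show "(\<lambda>x. norm (f x - c)) \<in> borel_measurable M" for c
    by (intro measurable_compose[OF assms(1) borel_measurable_continuous_onI])
qed

lemma borel_measurable_norm_nonseparable:
  fixes f :: "'a \<Rightarrow> 'b::real_normed_vector"
  assumes "f \<in> borel_measurable M"
  shows "(\<lambda>x. norm (f x)) \<in> borel_measurable M"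
  using borel_measurable_norm_diff_simple[OF assms simple_function_const[of _ 0]] by simp

text \<open>
  Rounding down to a multiple of \<open>1 / (i + 1)\<close> turns a bounded real function into a simple one, with
  an error that is uniformly small.
\<close>

definition round_down :: "nat \<Rightarrow> real \<Rightarrow> real" where
  "round_down i x = of_int \<lfloor>real (Suc i) * x\<rfloor> / real (Suc i)"

lemma round_down_error: "\<bar>x - round_down i x\<bar> \<le> 1 / real (Suc i)"
proof -
  have "\<bar>real (Suc i) * x - of_int \<lfloor>real (Suc i) * x\<rfloor>\<bar> \<le> 1" by linarith
  moreover have "x - round_down i x = (real (Suc i) * x - of_int \<lfloor>real (Suc i) * x\<rfloor>) / real (Suc i)"
    by (simp add: round_down_def diff_divide_distrib del: of_nat_Suc)
  ultimately show ?thesis by (simp add: divide_right_mono del: of_nat_Suc)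
qed

lemma round_down_tendsto: "(\<lambda>i. round_down i x) \<longlonglongrightarrow> x"
proof -
  have "(\<lambda>i. round_down i x - x) \<longlonglongrightarrow> 0"
  proof (rule Lim_null_comparison)
    show "(\<lambda>i. 1 / real (Suc i)) \<longlonglongrightarrow> 0" using LIMSEQ_inverse_real_of_nat
      by (simp add: inverse_eq_divide)
  qed (use round_down_error[of x] in \<open>auto simp: abs_minus_commute\<close>)
  then show ?thesis by (simp add: LIM_zero_cancel)
qed

lemma simple_function_round_down:
  assumes [measurable]: "\<phi> \<in> borel_measurable M" and bound: "\<And>x. x \<in> space M \<Longrightarrow> \<bar>\<phi> x\<bar> \<le> B"
  shows "simple_function M (\<lambda>x. round_down i (\<phi> x))"
proof (rule simple_function_borel_measurable)
  show "(\<lambda>x. round_down i (\<phi> x)) \<in> borel_measurable M"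
    unfolding round_down_def by measurable
  \<comment> \<open>On the range of \<open>\<phi>\<close> the rounded value is one of finitely many multiples of \<open>1 / (i + 1)\<close>.\<close>
  let ?J = "{\<lfloor>- (real (Suc i) * B)\<rfloor> .. \<lfloor>real (Suc i) * B\<rfloor>}"
  have "(\<lambda>x. round_down i (\<phi> x)) ` space M \<subseteq> (\<lambda>k. of_int k / real (Suc i)) ` ?J"
  proof
    fix y assume "y \<in> (\<lambda>x. round_down i (\<phi> x)) ` space M"
    then obtain x where x: "x \<in> space M" "y = of_int \<lfloor>real (Suc i) * \<phi> x\<rfloor> / real (Suc i)"
      by (auto simp: round_down_def)
    have "\<bar>real (Suc i) * \<phi> x\<bar> \<le> real (Suc i) * B"
      using bound[OF x(1)] unfolding abs_mult by (intro mult_mono) auto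
    then have "\<lfloor>real (Suc i) * \<phi> x\<rfloor> \<in> ?J"
      unfolding atLeastAtMost_iff by (intro conjI floor_mono) linarith+
    then show "y \<in> (\<lambda>k. of_int k / real (Suc i)) ` ?J" using x(2) by blast
  qed
  then show "finite ((\<lambda>x. round_down i (\<phi> x)) ` space M)"
    by (rule finite_subset) simp
qed

text \<open>
  The product is a pointwise limit of products with the simple functions obtained by rounding.
\<close>

lemma borel_measurable_scaleR_nonseparable:
  fixes f :: "'a \<Rightarrow> 'b::real_normed_vector"
  assumes \<phi>: "\<phi> \<in> borel_measurable M" "\<And>x. x \<in> space M \<Longrightarrow> \<bar>\<phi> x\<bar> \<le> B"
    and f: "f \<in> borel_measurable M"
  shows "(\<lambda>x. \<phi> x *\<^sub>R f x) \<in> borel_measurable M"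
proof (rule borel_measurable_LIMSEQ_metric)
  show "(\<lambda>x. round_down i (\<phi> x) *\<^sub>R f x) \<in> borel_measurable M" for i
  proof (rule measurable_compose_simple[OF simple_function_round_down[OF \<phi>]])
    have "continuous_on UNIV (\<lambda>y::'b. c *\<^sub>R y)" for c by (intro continuous_intros)
    then show "(\<lambda>x. c *\<^sub>R f x) \<in> borel_measurable M" for c
      by (intro measurable_compose[OF f borel_measurable_continuous_onI])
  qed
  show "(\<lambda>i. round_down i (\<phi> x) *\<^sub>R f x) \<longlonglongrightarrow> \<phi> x *\<^sub>R f x" for x
    by (intro tendsto_intros round_down_tendsto)
qed

text \<open>
  A Riemann sum of \<open>f - s i\<close> is dominated in norm by the same Riemann sum of \<open>norm (f - s i)\<close>, which
  is close to the small number \<open>e i\<close> on fine divisions.  So the Riemann sums of \<open>f\<close> stay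
  close to those of \<open>s i\<close>.
\<close>

lemma has_integral_L1_limit:
  fixes f :: "real \<Rightarrow> 'b::real_normed_vector"
  assumes s: "\<And>i. (s i has_integral S i) {a..b}" and S: "S \<longlonglongrightarrow> x"
    and e: "\<And>i. ((\<lambda>t. norm (f t - s i t)) has_integral e i) {a..b}" and lim: "e \<longlonglongrightarrow> 0"
  shows "(f has_integral x) {a..b}"
  unfolding has_integral_real
proof (intro allI impI)
  fix \<epsilon> :: real assume "\<epsilon> > 0"
  then have \<epsilon>4: "\<epsilon> / 4 > 0" by simp
  have "\<forall>\<^sub>F i in sequentially. norm (S i - x) < \<epsilon> / 4 \<and> e i < \<epsilon> / 4"
    using tendstoD[OF S \<epsilon>4] order_tendstoD(2)[OF lim \<epsilon>4]
    unfolding dist_norm by (rule eventually_conj)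
  then obtain i where i: "norm (S i - x) < \<epsilon> / 4" "e i < \<epsilon> / 4"
    using eventually_happens'[OF sequentially_bot] by blast
  obtain \<gamma>1 where \<gamma>1: "gauge \<gamma>1" "\<forall>p. p tagged_division_of {a..b} \<and> \<gamma>1 fine p \<longrightarrow>
      norm ((\<Sum>(t,K)\<in>p. measure lborel K *\<^sub>R s i t) - S i) < \<epsilon> / 4"
    using s[of i, unfolded has_integral_real, rule_format, OF \<epsilon>4] by (elim exE conjE) (rule that)
  obtain \<gamma>2 where \<gamma>2: "gauge \<gamma>2" "\<forall>p. p tagged_division_of {a..b} \<and> \<gamma>2 fine p \<longrightarrow>
      norm ((\<Sum>(t,K)\<in>p. measure lborel K *\<^sub>R norm (f t - s i t)) - e i) < \<epsilon> / 4"
    using e[of i, unfolded has_integral_real, rule_format, OF \<epsilon>4] by (elim exE conjE) (rule that)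
  show "\<exists>\<gamma>. gauge \<gamma> \<and> (\<forall>\<D>. \<D> tagged_division_of {a..b} \<and> \<gamma> fine \<D> \<longrightarrow>
      norm ((\<Sum>(t,K)\<in>\<D>. measure lborel K *\<^sub>R f t) - x) < \<epsilon>)"
  proof (rule exI[of _ "\<lambda>t. \<gamma>1 t \<inter> \<gamma>2 t"], intro conjI allI impI)
    show "gauge (\<lambda>t. \<gamma>1 t \<inter> \<gamma>2 t)" using \<gamma>1(1) \<gamma>2(1) by (rule gauge_Int)
    fix p assume "p tagged_division_of {a..b} \<and> (\<lambda>t. \<gamma>1 t \<inter> \<gamma>2 t) fine p"
    then have p: "p tagged_division_of {a..b}" and fine: "\<gamma>1 fine p" "\<gamma>2 fine p"
      by (simp_all add: fine_Int)
    define R where "R g = (\<Sum>(t,K)\<in>p. measure lborel K *\<^sub>R g t)" for g :: "real \<Rightarrow> 'b"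
    define Q where "Q = (\<Sum>(t,K)\<in>p. measure lborel K *\<^sub>R norm (f t - s i t))"
    have 1: "norm (R (s i) - S i) < \<epsilon> / 4" and 2: "norm (Q - e i) < \<epsilon> / 4"
      using \<gamma>1(2)[rule_format, OF conjI[OF p fine(1)]] \<gamma>2(2)[rule_format, OF conjI[OF p fine(2)]] unfolding R_def Q_def by this+
    have 3: "norm (R (\<lambda>t. f t - s i t)) \<le> Q"
      unfolding R_def Q_def by (intro sum_norm_le) (simp add: split_def)
    have "R f = R (\<lambda>t. (f t - s i t) + s i t)" by simp
    also have "\<dots> = R (\<lambda>t. f t - s i t) + R (s i)"
      unfolding R_def split_def scaleR_add_right by (rule sum.distrib)
    finally have "R f - x = R (\<lambda>t. f t - s i t) + ((R (s i) - S i) + (S i - x))"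
      by simp
    then have "norm (R f - x) \<le> norm (R (\<lambda>t. f t - s i t)) + (norm (R (s i) - S i) + norm (S i - x))"
      by (metis norm_triangle_le add_left_mono norm_triangle_ineq)
    then have "norm (R f - x) < \<epsilon>" using 1 2 3 i unfolding real_norm_def by linarith
    then show "norm ((\<Sum>(t,K)\<in>p. measure lborel K *\<^sub>R f t) - x) < \<epsilon>"
      unfolding R_def .
  qed
qed

lemma has_integral_nn_integral_lebesgue_on:
  fixes f :: "real \<Rightarrow> real"
  assumes "f \<in> borel_measurable (lebesgue_on {a..b})" "\<And>x. 0 \<le> f x"
    and fin: "(\<integral>\<^sup>+x. f x \<partial>lebesgue_on {a..b}) < \<infinity>"
  shows "(f has_integral enn2real (\<integral>\<^sup>+x. f x \<partial>lebesgue_on {a..b})) {a..b}"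
proof -
  have "integrable (lebesgue_on {a..b}) f"
    using assms by (intro integrableI_nonneg) auto
  from has_integral_integral_lebesgue_on[OF this]
  show ?thesis using assms by (simp add: integral_eq_nn_integral)
qed

lemma simple_bochner_integrable_lebesgue_on:
  fixes s :: "real \<Rightarrow> 'b::real_vector"
  assumes "simple_function (lebesgue_on {a..b}) s"
  shows "Bochner_Integration.simple_bochner_integrable (lebesgue_on {a..b}) s"
proof
  interpret finite_measure "lebesgue_on {a..b}"
    by (rule finite_measure_lebesgue_on) simp
  show "emeasure (lebesgue_on {a..b}) {y \<in> space (lebesgue_on {a..b}). s y \<noteq> 0} \<noteq> \<infinity>"
    by (simp add: emeasure_finite)
qed (rule assms)

text \<open>
  On the interval a simple function is the finite sum of the multiples \<open>indicator A * y\<close> over its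
  values \<open>y\<close> and their level sets \<open>A\<close>.
\<close>

lemma has_integral_simple:
  fixes s :: "real \<Rightarrow> 'b::real_normed_vector"
  assumes s: "simple_function (lebesgue_on {a..b}) s"
  shows "(s has_integral Bochner_Integration.simple_bochner_integral (lebesgue_on {a..b}) s) {a..b}"
proof -
  let ?M = "lebesgue_on {a..b}"
  have fin: "finite (s ` {a..b})" using simple_functionD(1)[OF s] by simp
  have *: "((\<lambda>x. indicat_real (s -` {y} \<inter> {a..b}) x *\<^sub>R y) has_integral
      measure ?M {x \<in> space ?M. s x = y} *\<^sub>R y) {a..b}" for y
  proof (rule has_integral_scaleR_left)
    let ?A = "s -` {y} \<inter> {a..b}"
    have A: "?A \<in> sets ?M" using simple_functionD(2)[OF s, of "{y}"] by simp
    have eq: "{x \<in> space ?M. s x = y} = ?A" by auto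
    have "integrable ?M (indicat_real ?A)"
      using A by (intro integrable_real_indicator)
        (auto simp: finite_measure.emeasure_finite[OF finite_measure_lebesgue_on] less_top[symmetric])
    from has_integral_integral_lebesgue_on[OF this] A
    show "(indicat_real ?A has_integral measure ?M {x \<in> space ?M. s x = y}) {a..b}"
      unfolding eq by (simp add: Int_absorb2 Int_assoc)
  qed
  have "((\<lambda>x. \<Sum>y\<in>s ` {a..b}. indicat_real (s -` {y} \<inter> {a..b}) x *\<^sub>R y) has_integral
      (\<Sum>y\<in>s ` {a..b}. measure ?M {x \<in> space ?M. s x = y} *\<^sub>R y)) {a..b}"
    using fin * by (intro has_integral_sum) auto
  moreover have "(\<Sum>y\<in>s ` {a..b}. indicat_real (s -` {y} \<inter> {a..b}) x *\<^sub>R y) = s x"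
    if "x \<in> {a..b}" for x
  proof -
    have "(\<Sum>y\<in>s ` {a..b}. indicat_real (s -` {y} \<inter> {a..b}) x *\<^sub>R y)
        = (\<Sum>y\<in>s ` {a..b}. if y = s x then y else 0)"
      using that by (intro sum.cong) auto
    then show ?thesis using fin that by simp
  qed
  ultimately have "(s has_integral (\<Sum>y\<in>s ` {a..b}. measure ?M {x \<in> space ?M. s x = y} *\<^sub>R y)) {a..b}"
    by (rule has_integral_eq[rotated])
  then show ?thesis
    by (simp add: Bochner_Integration.simple_bochner_integral_def)
qed

text \<open>
  The approximating simple functions converge to \<open>f\<close> in \<open>L\<^sup>1\<close>, their Bochner and Henstock-Kurzweil
  integrals agree, and Henstock-Kurzweil integrals pass to \<open>L\<^sup>1\<close> limits.
\<close>

lemma has_bochner_int_has_integral: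
  fixes f :: "real \<Rightarrow> 'b::real_normed_vector"
  assumes "has_bochner_int (lebesgue_on {a..b}) f x"
  shows "(f has_integral x) {a..b}"
proof -
  let ?M = "lebesgue_on {a..b}"
  obtain s where f: "f \<in> borel_measurable ?M"
    and s: "\<And>i. Bochner_Integration.simple_bochner_integrable ?M (s i)"
    and L1: "(\<lambda>i. \<integral>\<^sup>+y. norm (f y - s i y) \<partial>?M) \<longlonglongrightarrow> 0"
    and lim: "(\<lambda>i. Bochner_Integration.simple_bochner_integral ?M (s i)) \<longlonglongrightarrow> x"
    using assms unfolding has_bochner_int_def by blast
  have s': "simple_function ?M (s i)" for i
    using s[of i] by (rule Bochner_Integration.simple_bochner_integrable.cases)
  define e where "e i = (\<integral>\<^sup>+y. norm (f y - s i y) \<partial>?M)" for i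
  \<comment> \<open>Possibly only a tail of the sequence has finite distance to \<open>f\<close>; the approximation starts from there.\<close>
  obtain i0 where i0: "\<And>i. i \<ge> i0 \<Longrightarrow> e i < \<infinity>"
    using order_tendstoD(2)[OF L1, of \<infinity>] by (auto simp: e_def eventually_sequentially)
  show ?thesis
  proof (rule has_integral_L1_limit)
    show "(s (i + i0) has_integral Bochner_Integration.simple_bochner_integral ?M (s (i + i0))) {a..b}" for i
      by (rule has_integral_simple[OF s'])
    show "(\<lambda>i. Bochner_Integration.simple_bochner_integral ?M (s (i + i0))) \<longlonglongrightarrow> x"
      using lim by (rule LIMSEQ_ignore_initial_segment)
    show "((\<lambda>t. norm (f t - s (i + i0) t)) has_integral enn2real (e (i + i0))) {a..b}" for i
      unfolding e_def
      by (intro has_integral_nn_integral_lebesgue_on borel_measurable_norm_diff_simple f s')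
        (use i0[of "i + i0"] in \<open>auto simp: e_def\<close>)
    have "(\<lambda>i. enn2real (e i)) \<longlonglongrightarrow> enn2real 0"
      using L1 unfolding e_def by (intro tendsto_enn2real) auto
    then show "(\<lambda>i. enn2real (e (i + i0))) \<longlonglongrightarrow> 0"
      using LIMSEQ_ignore_initial_segment by fastforce
  qed
qed

lemma bochner_integrable_has_integral:
  fixes f :: "real \<Rightarrow> 'b::real_normed_vector"
  assumes "bochner_integrable (lebesgue_on {a..b}) f"
  shows "f integrable_on {a..b}" "bochner_int (lebesgue_on {a..b}) f = integral {a..b} f"
proof -
  obtain x where x: "has_bochner_int (lebesgue_on {a..b}) f x"
    using assms unfolding bochner_integrable_def by blast
  then have int: "(f has_integral x) {a..b}" by (rule has_bochner_int_has_integral)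
  then show "f integrable_on {a..b}" by blast
  have "y = x" if "has_bochner_int (lebesgue_on {a..b}) f y" for y
    using has_integral_unique[OF has_bochner_int_has_integral[OF that] int] .
  then have "(THE y. has_bochner_int (lebesgue_on {a..b}) f y) = x"
    using x by blast
  then show "bochner_int (lebesgue_on {a..b}) f = integral {a..b} f"
    using x int unfolding bochner_int_def by (auto simp: integral_unique)
qed

lemma bochner_integrable_L1:
  fixes f :: "real \<Rightarrow> 'b::real_normed_vector"
  assumes "bochner_integrable (lebesgue_on {a..b}) f"
  obtains s where "f \<in> borel_measurable (lebesgue_on {a..b})"
    and "\<And>i. simple_function (lebesgue_on {a..b}) (s i)"
    and "(\<lambda>i. \<integral>\<^sup>+y. norm (f y - s i y) \<partial>lebesgue_on {a..b}) \<longlonglongrightarrow> 0"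
  using assms that
  unfolding bochner_integrable_def has_bochner_int_def
    Bochner_Integration.simple_bochner_integrable.simps by blast

text \<open>
  The existence of the limit of the integrals is automatic: they form a Cauchy sequence because
  the distance of two of them is at most the sum of the \<open>L\<^sup>1\<close> distances to \<open>f\<close>.
\<close>

lemma bochner_integrableI_L1:
  fixes f :: "real \<Rightarrow> 'b::banach"
  assumes f: "f \<in> borel_measurable (lebesgue_on {a..b})"
    and s: "\<And>i. simple_function (lebesgue_on {a..b}) (s i)"
    and L1: "(\<lambda>i. \<integral>\<^sup>+y. norm (f y - s i y) \<partial>lebesgue_on {a..b}) \<longlonglongrightarrow> 0"
  shows "bochner_integrable (lebesgue_on {a..b}) f"
proof -
  let ?M = "lebesgue_on {a..b}"
  define S where "S i = Bochner_Integration.simple_bochner_integral ?M (s i)" for i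
  define e where "e i = (\<integral>\<^sup>+y. norm (f y - s i y) \<partial>?M)" for i
  have S: "(s i has_integral S i) {a..b}" for i
    unfolding S_def by (rule has_integral_simple[OF s])
  have e: "((\<lambda>t. norm (f t - s i t)) has_integral enn2real (e i)) {a..b}" if "e i < \<infinity>" for i
    unfolding e_def
    by (intro has_integral_nn_integral_lebesgue_on borel_measurable_norm_diff_simple f s)
      (use that in \<open>auto simp: e_def\<close>)
  have "Cauchy S"
  proof (rule metric_CauchyI)
    fix \<epsilon> :: real assume "\<epsilon> > 0"
    then obtain n0 where n0: "\<And>i. i \<ge> n0 \<Longrightarrow> e i < ennreal (\<epsilon> / 2)"
      using order_tendstoD(2)[OF L1, of "ennreal (\<epsilon> / 2)"]
      by (auto simp: e_def eventually_sequentially)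
    have fin: "e i < \<infinity>" if "i \<ge> n0" for i
      using n0[OF that] by (rule less_trans) simp
    have small: "enn2real (e i) < \<epsilon> / 2" if "i \<ge> n0" for i
      using n0[OF that] fin[OF that] \<open>\<epsilon> > 0\<close>
      by (cases "e i") (auto simp: ennreal_less_iff)
    have "dist (S i) (S j) < \<epsilon>" if ij: "i \<ge> n0" "j \<ge> n0" for i j
    proof -
      have "norm (S i - S j) \<le> enn2real (e i) + enn2real (e j)"
      proof (rule has_integral_norm_bound_integral_component[where k = "1::real", simplified])
        show "((\<lambda>t. s i t - s j t) has_integral S i - S j) {a..b}"
          using S S by (rule has_integral_diff)
        show "((\<lambda>t. norm (f t - s i t) + norm (f t - s j t)) has_integral
            enn2real (e i) + enn2real (e j)) {a..b}"
          by (intro has_integral_add e fin ij)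
        show "norm (s i t - s j t) \<le> norm (f t - s i t) + norm (f t - s j t)" for t
          using norm_triangle_ineq4[of "f t - s j t" "f t - s i t"] by simp
      qed
      then show ?thesis using small[OF ij(1)] small[OF ij(2)] by (simp add: dist_norm)
    qed
    then show "\<exists>M. \<forall>m\<ge>M. \<forall>n\<ge>M. dist (S m) (S n) < \<epsilon>" by blast
  qed
  then obtain x where "S \<longlonglongrightarrow> x" using Cauchy_convergent convergent_def by blast
  then have "has_bochner_int ?M f x"
    unfolding has_bochner_int_def S_def
    using f L1 simple_bochner_integrable_lebesgue_on[OF s] by blast
  then show ?thesis unfolding bochner_integrable_def by blast
qed

text \<open>
  Some simple function has finite distance to \<open>f\<close>, and it is bounded on an interval of finite
  measure.
\<close>

lemma bochner_integrable_norm: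
  fixes f :: "real \<Rightarrow> 'b::real_normed_vector"
  assumes "bochner_integrable (lebesgue_on {a..b}) f"
  shows "(\<integral>\<^sup>+x. norm (f x) \<partial>lebesgue_on {a..b}) < \<infinity>"
    and "(\<lambda>x. norm (f x)) integrable_on {a..b}"
proof -
  let ?M = "lebesgue_on {a..b}"
  obtain s where f: "f \<in> borel_measurable ?M"
    and s: "\<And>i. simple_function ?M (s i)"
    and L1: "(\<lambda>i. \<integral>\<^sup>+y. norm (f y - s i y) \<partial>?M) \<longlonglongrightarrow> 0"
    using bochner_integrable_L1[OF assms] by blast
  obtain i where i: "(\<integral>\<^sup>+y. norm (f y - s i y) \<partial>?M) < \<infinity>"
    using eventually_happens[OF order_tendstoD(2)[OF L1, of \<infinity>]] by auto
  have "finite (s i ` {a..b})" using simple_functionD(1)[OF s] by simp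
  then obtain B where B: "\<And>y. y \<in> {a..b} \<Longrightarrow> norm (s i y) \<le> B"
    using finite_imp_bounded[of "s i ` {a..b}"] unfolding bounded_iff ball_simps by blast
  have "(\<integral>\<^sup>+y. norm (f y) \<partial>?M) \<le> (\<integral>\<^sup>+y. ennreal (norm (f y - s i y)) + ennreal (max 0 B) \<partial>?M)"
  proof (rule nn_integral_mono)
    fix y assume "y \<in> space ?M"
    then have "norm (f y) \<le> norm (f y - s i y) + max 0 B"
      using B[of y] norm_triangle_ineq[of "f y - s i y" "s i y"] by simp
    then show "ennreal (norm (f y)) \<le> ennreal (norm (f y - s i y)) + ennreal (max 0 B)"
      by (simp flip: ennreal_plus add: ennreal_leI)
  qed
  also have "\<dots> = (\<integral>\<^sup>+y. norm (f y - s i y) \<partial>?M) + (\<integral>\<^sup>+y. ennreal (max 0 B) \<partial>?M)"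
    using borel_measurable_norm_diff_simple[OF f s[of i]] by (intro nn_integral_add) auto
  also have "\<dots> < \<infinity>"
    using i finite_measure.emeasure_finite[OF finite_measure_lebesgue_on, of "{a..b}" "{a..b}"]
    by (simp add: ennreal_mult_less_top less_top)
  finally show fin: "(\<integral>\<^sup>+x. norm (f x) \<partial>?M) < \<infinity>" .
  show "(\<lambda>x. norm (f x)) integrable_on {a..b}"
    using has_integral_nn_integral_lebesgue_on[OF borel_measurable_norm_nonseparable[OF f] _ fin] by auto
qed

lemma round_down_scaleR_error:
  fixes y z :: "'b::real_normed_vector"
  assumes "\<bar>r\<bar> \<le> B"
  shows "norm (r *\<^sub>R y - round_down i r *\<^sub>R z)
    \<le> 1 / real (Suc i) * norm y + (B + 1) * norm (y - z)"
proof -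
  have "1 / real (Suc i) \<le> 1" by simp
  then have "\<bar>round_down i r\<bar> \<le> B + 1"
    using round_down_error[of r i] assms by linarith
  then have 1: "norm (round_down i r *\<^sub>R (y - z)) \<le> (B + 1) * norm (y - z)"
    unfolding norm_scaleR real_norm_def by (rule mult_right_mono) simp
  have 2: "norm ((r - round_down i r) *\<^sub>R y) \<le> 1 / real (Suc i) * norm y"
    unfolding norm_scaleR real_norm_def by (rule mult_right_mono[OF round_down_error]) simp
  have "r *\<^sub>R y - round_down i r *\<^sub>R z
      = (r - round_down i r) *\<^sub>R y + round_down i r *\<^sub>R (y - z)"
    by (simp add: scaleR_diff_left scaleR_diff_right)
  then show ?thesis
    using norm_triangle_mono[OF 2 1] by (simp only:)
qed

text \<open>
  The integrands are real, so that pointwise estimates of norms apply directly.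
\<close>

lemma nn_integral_affine_bound:
  assumes [measurable]: "g \<in> borel_measurable M" "h \<in> borel_measurable M"
    and nonneg: "0 \<le> c" "0 \<le> d" "\<And>x. 0 \<le> g x" "\<And>x. 0 \<le> h x"
    and bound: "\<And>x. x \<in> space M \<Longrightarrow> f x \<le> c * g x + d * h x"
  shows "(\<integral>\<^sup>+x. ennreal (f x) \<partial>M) \<le> ennreal c * (\<integral>\<^sup>+x. ennreal (g x) \<partial>M) + ennreal d * (\<integral>\<^sup>+x. ennreal (h x) \<partial>M)"
proof -
  have "(\<integral>\<^sup>+x. ennreal (f x) \<partial>M) \<le> (\<integral>\<^sup>+x. ennreal c * ennreal (g x) + ennreal d * ennreal (h x) \<partial>M)"
  proof (rule nn_integral_mono)
    fix x assume "x \<in> space M"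
    then have "ennreal (f x) \<le> ennreal (c * g x + d * h x)" by (intro ennreal_leI bound)
    also have "\<dots> = ennreal c * ennreal (g x) + ennreal d * ennreal (h x)"
      using nonneg by (simp add: ennreal_mult)
    finally show "ennreal (f x) \<le> ennreal c * ennreal (g x) + ennreal d * ennreal (h x)" .
  qed
  also have "\<dots> = ennreal c * (\<integral>\<^sup>+x. ennreal (g x) \<partial>M) + ennreal d * (\<integral>\<^sup>+x. ennreal (h x) \<partial>M)"
    by (simp add: nn_integral_add nn_integral_cmult)
  finally show ?thesis .
qed

text \<open>
  Rounding \<open>\<phi>\<close> and approximating \<open>f\<close> by simple functions \<open>s i\<close> at the same time gives simple
  functions; the error splits into the rounding error times \<open>norm f\<close> and a bounded factor
  times \<open>norm (f - s i)\<close>.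
\<close>

lemma bochner_integrable_scaleR:
  fixes f :: "real \<Rightarrow> 'b::banach"
  assumes f: "bochner_integrable (lebesgue_on {a..b}) f"
    and \<phi>: "\<phi> \<in> borel_measurable (lebesgue_on {a..b})" "\<And>x. x \<in> {a..b} \<Longrightarrow> \<bar>\<phi> x\<bar> \<le> B"
    and "0 \<le> B"
  shows "bochner_integrable (lebesgue_on {a..b}) (\<lambda>x. \<phi> x *\<^sub>R f x)"
proof -
  let ?M = "lebesgue_on {a..b}"
  obtain s where fm: "f \<in> borel_measurable ?M"
    and s: "\<And>i. simple_function ?M (s i)"
    and L1: "(\<lambda>i. \<integral>\<^sup>+y. norm (f y - s i y) \<partial>?M) \<longlonglongrightarrow> 0"
    using bochner_integrable_L1[OF f] by blast
  have \<phi>': "\<And>x. x \<in> space ?M \<Longrightarrow> \<bar>\<phi> x\<bar> \<le> B" using \<phi>(2) by simp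
  define t where "t i x = round_down i (\<phi> x) *\<^sub>R s i x" for i x
  define E where "E i = ennreal (1 / real (Suc i)) * (\<integral>\<^sup>+y. norm (f y) \<partial>?M)
        + ennreal (B + 1) * (\<integral>\<^sup>+y. norm (f y - s i y) \<partial>?M)" for i
  have le: "(\<integral>\<^sup>+y. norm (\<phi> y *\<^sub>R f y - t i y) \<partial>?M) \<le> E i" for i
    unfolding E_def t_def
  proof (rule nn_integral_affine_bound)
    show "norm (\<phi> y *\<^sub>R f y - round_down i (\<phi> y) *\<^sub>R s i y)
        \<le> 1 / real (Suc i) * norm (f y) + (B + 1) * norm (f y - s i y)"
      if "y \<in> space ?M" for y
      by (rule round_down_scaleR_error[OF \<phi>'[OF that]])
  qed (use \<open>0 \<le> B\<close> borel_measurable_norm_nonseparable[OF fm] borel_measurable_norm_diff_simple[OF fm s] in simp_all)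
  have "(\<lambda>i. 1 / real (Suc i)) \<longlonglongrightarrow> 0"
    using LIMSEQ_inverse_real_of_nat unfolding inverse_eq_divide .
  then have null: "(\<lambda>i. ennreal (1 / real (Suc i))) \<longlonglongrightarrow> ennreal 0"
    by (rule tendsto_ennrealI)
  have "(\<lambda>i. ennreal (1 / real (Suc i)) * (\<integral>\<^sup>+y. norm (f y) \<partial>?M))
      \<longlonglongrightarrow> ennreal 0 * (\<integral>\<^sup>+y. norm (f y) \<partial>?M)"
    using null bochner_integrable_norm(1)[OF f]
    by (intro tendsto_mult_ennreal tendsto_const) simp_all
  moreover have "(\<lambda>i. ennreal (B + 1) * (\<integral>\<^sup>+y. norm (f y - s i y) \<partial>?M)) \<longlonglongrightarrow> ennreal (B + 1) * 0"
    using L1 by (intro ennreal_tendsto_cmult) simp_all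
  ultimately have "E \<longlonglongrightarrow> ennreal 0 * (\<integral>\<^sup>+y. norm (f y) \<partial>?M) + ennreal (B + 1) * 0"
    unfolding E_def by (rule tendsto_add)
  then have E: "E \<longlonglongrightarrow> 0" by simp
  show ?thesis
  proof (rule bochner_integrableI_L1)
    show "(\<lambda>x. \<phi> x *\<^sub>R f x) \<in> borel_measurable ?M"
      by (rule borel_measurable_scaleR_nonseparable[OF \<phi>(1) \<phi>' fm])
    show "simple_function ?M (t i)" for i
      unfolding t_def
      by (rule simple_function_compose2[where h = scaleR, OF simple_function_round_down[OF \<phi>(1) \<phi>'] s])
    show "(\<lambda>i. \<integral>\<^sup>+y. norm (\<phi> y *\<^sub>R f y - t i y) \<partial>?M) \<longlonglongrightarrow> 0"
      by (rule tendsto_sandwich[OF always_eventually always_eventually tendsto_const E])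
        (use le in simp_all)
  qed
qed

section \<open>Averages in continuous time\<close>

text \<open>
  Summation by parts for a function \<open>f\<close> whose primitive is differentiable only almost everywhere,
  if at all.  The defect of integration by parts up to time \<open>t\<close> is
  \<open>G t = \<integral>\<^sub>a\<^sup>t \<phi> f - \<phi> t * \<integral>\<^sub>a\<^sup>t f\<close>.  Over a short interval \<open>{u..v}\<close> its increment is
  \<open>\<integral>\<^sub>u\<^sup>v (\<phi> - \<phi> v) f - (\<phi> v - \<phi> u) * \<integral>\<^sub>a\<^sup>u f\<close>.  Summed over a uniform division, the first terms are
  at most \<open>L\<close> times the mesh times the integral of \<open>h\<close>, which disappears in the limit, and the
  second terms are at most \<open>L (b - a) K\<close>.
\<close>

lemma integral_bound_by_variation:
  fixes f :: "real \<Rightarrow> 'b::banach"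
  assumes "a \<le> b"
    and f: "f integrable_on {a..b}"
    and \<phi>f: "(\<lambda>s. \<phi> s *\<^sub>R f s) integrable_on {a..b}"
    and h: "h integrable_on {a..b}" "\<And>s. s \<in> {a..b} \<Longrightarrow> norm (f s) \<le> h s"
    and lip: "L-lipschitz_on {a..b} \<phi>" and "\<phi> b = 0"
    and K: "\<And>t. t \<in> {a..b} \<Longrightarrow> norm (integral {a..t} f) \<le> K"
  shows "norm (integral {a..b} (\<lambda>s. \<phi> s *\<^sub>R f s)) \<le> L * (b - a) * K"
proof -
  have L: "L \<ge> 0" using lip by (rule lipschitz_on_nonneg)
  define F where "F t = integral {a..t} f" for t
  define H where "H t = integral {a..t} h" for t
  define G where "G t = integral {a..t} (\<lambda>s. \<phi> s *\<^sub>R f s) - \<phi> t *\<^sub>R F t" for t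
  have sub: "g integrable_on {u..v}" if "g integrable_on {a..b}" "a \<le> u" "v \<le> b"
    for g :: "real \<Rightarrow> 'c::banach" and u v
    using that by (intro integrable_on_subinterval[OF that(1)]) auto
  have split: "integral {u..v} g = integral {a..v} g - integral {a..u} g"
    if "g integrable_on {a..b}" "a \<le> u" "u \<le> v" "v \<le> b"
    for g :: "real \<Rightarrow> 'c::banach" and u v
    using Henstock_Kurzweil_Integration.integral_combine[OF that(2,3) sub[OF that(1) order_refl that(4)]]
    by (simp add: algebra_simps)
  have step: "norm (G v - G u) \<le> L * (v - u) * (H v - H u + K)"
    if uv: "a \<le> u" "u \<le> v" "v \<le> b" for u v
  proof -
    have int: "(\<lambda>s. (\<phi> s - \<phi> v) *\<^sub>R f s) integrable_on {u..v}"
      unfolding scaleR_diff_left using uv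
      by (intro integrable_diff integrable_cmul sub[OF f] sub[OF \<phi>f])
    have "integral {u..v} (\<lambda>s. (\<phi> s - \<phi> v) *\<^sub>R f s)
        = integral {u..v} (\<lambda>s. \<phi> s *\<^sub>R f s) - \<phi> v *\<^sub>R integral {u..v} f"
      unfolding scaleR_diff_left using uv
      by (subst Henstock_Kurzweil_Integration.integral_diff)
        (auto intro!: integrable_cmul sub[OF f] sub[OF \<phi>f])
    also have "\<dots> = (G v - G u) + (\<phi> v - \<phi> u) *\<^sub>R F u"
      unfolding split[OF f uv] split[OF \<phi>f uv] G_def F_def by (simp add: algebra_simps)
    finally have "G v - G u
        = integral {u..v} (\<lambda>s. (\<phi> s - \<phi> v) *\<^sub>R f s) - (\<phi> v - \<phi> u) *\<^sub>R F u"
      by simp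
    also have "norm \<dots> \<le> L * (v - u) * (H v - H u) + L * (v - u) * K"
    proof (intro order_trans[OF norm_triangle_ineq4] add_mono)
      have "norm (integral {u..v} (\<lambda>s. (\<phi> s - \<phi> v) *\<^sub>R f s))
          \<le> integral {u..v} (\<lambda>s. L * (v - u) * h s)"
      proof (rule Henstock_Kurzweil_Integration.integral_norm_bound_integral[OF int])
        show "(\<lambda>s. L * (v - u) * h s) integrable_on {u..v}"
          using sub[OF h(1)] uv by (intro integrable_on_mult_right) auto
        fix s assume s: "s \<in> {u..v}"
        have "\<bar>\<phi> s - \<phi> v\<bar> \<le> L * \<bar>s - v\<bar>"
          using lipschitz_onD[OF lip, of s v] s uv by (simp add: dist_real_def)
        also have "\<dots> \<le> L * (v - u)" using s L by (intro mult_left_mono) auto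
        finally show "norm ((\<phi> s - \<phi> v) *\<^sub>R f s) \<le> L * (v - u) * h s"
          unfolding norm_scaleR real_norm_def using h(2)[of s] s uv by (intro mult_mono) auto
      qed
      also have "\<dots> = L * (v - u) * (H v - H u)"
        unfolding integral_mult_right H_def split[OF h(1) uv] ..
      finally show "norm (integral {u..v} (\<lambda>s. (\<phi> s - \<phi> v) *\<^sub>R f s)) \<le> L * (v - u) * (H v - H u)" .
      have "\<bar>\<phi> v - \<phi> u\<bar> \<le> L * (v - u)"
        using lipschitz_onD[OF lip, of v u] uv by (simp add: dist_real_def)
      then show "norm ((\<phi> v - \<phi> u) *\<^sub>R F u) \<le> L * (v - u) * K"
        unfolding norm_scaleR real_norm_def F_def using K[of u] uv L by (intro mult_mono) auto
    qed
    finally show ?thesis by (simp add: distrib_left)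
  qed
  have mesh: "norm (G b - G a) \<le> L * (b - a) * H b / real (Suc n) + L * (b - a) * K" for n
  proof -
    define m where "m = Suc n"
    define \<delta> where "\<delta> = (b - a) / real m"
    define t where "t k = a + real k * \<delta>" for k
    have m: "real m > 0" by (simp add: m_def)
    have \<delta>: "\<delta> \<ge> 0" "real m * \<delta> = b - a" using \<open>a \<le> b\<close> m by (auto simp: \<delta>_def)
    have t: "t 0 = a" "t m = b" "t (Suc k) - t k = \<delta>" for k
      using \<delta>(2) by (auto simp: t_def algebra_simps)
    have t_range: "a \<le> t k" "t k \<le> t (Suc k)" "t (Suc k) \<le> b" if "k < m" for k
    proof -
      show "a \<le> t k" "t k \<le> t (Suc k)" using \<delta>(1) t(3)[of k] by (auto simp: t_def)
      have "real (Suc k) * \<delta> \<le> real m * \<delta>" using that \<delta>(1) by (intro mult_right_mono) auto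
      then show "t (Suc k) \<le> b" using \<delta>(2) unfolding t_def by linarith
    qed
    have "G b - G a = (\<Sum>k<m. G (t (Suc k)) - G (t k))"
      using sum_lessThan_telescope[of "\<lambda>k. G (t k)" m] by (simp add: t)
    also have "norm \<dots> \<le> (\<Sum>k<m. L * \<delta> * (H (t (Suc k)) - H (t k) + K))"
    proof (rule sum_norm_le)
      fix k assume "k \<in> {..<m}"
      then show "norm (G (t (Suc k)) - G (t k)) \<le> L * \<delta> * (H (t (Suc k)) - H (t k) + K)"
        using step[OF t_range, of k] t(3)[of k] by simp
    qed
    also have "\<dots> = L * \<delta> * ((\<Sum>k<m. H (t (Suc k)) - H (t k)) + real m * K)"
      by (simp add: sum_distrib_left[symmetric] sum.distrib)
    also have "(\<Sum>k<m. H (t (Suc k)) - H (t k)) = H b"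
      using sum_lessThan_telescope[of "\<lambda>k. H (t k)" m] by (simp add: t H_def)
    also have "L * \<delta> * (H b + real m * K) = L * \<delta> * H b + L * (real m * \<delta>) * K"
      by (simp add: algebra_simps)
    also have "\<dots> = L * (b - a) * H b / real (Suc n) + L * (b - a) * K"
      unfolding \<delta>(2) by (simp add: \<delta>_def m_def)
    finally show ?thesis .
  qed
  have "(\<lambda>n. L * (b - a) * H b / real (Suc n) + L * (b - a) * K) \<longlonglongrightarrow> 0 + L * (b - a) * K"
    by (intro tendsto_add tendsto_const LIMSEQ_Suc[OF lim_const_over_n])
  then have "norm (G b - G a) \<le> 0 + L * (b - a) * K"
    by (rule tendsto_lowerbound) (use mesh in auto)
  then show ?thesis using \<open>\<phi> b = 0\<close> by (simp add: G_def F_def)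
qed

context lipschitz_weight
begin

lemma has_integral_rescaled:
  assumes "N > 0"
  shows "((\<lambda>s. w (s / N)) has_integral N) {0..N}"
proof -
  have "(\<lambda>x. x / (1 / N)) ` {0..1} = {0..N}"
    using image_mult_atLeastAtMost[of N 0 1] assms by (simp add: mult.commute)
  then show ?thesis
    using has_integral_stretch_real[OF integral_one, of "1 / N"] assms by simp
qed

lemma lipschitz_rescaled:
  assumes "N > 0"
  shows "(L / N)-lipschitz_on A (\<lambda>s. w (s / N))"
proof (rule lipschitz_onI)
  fix x y
  show "dist (w (x / N)) (w (y / N)) \<le> L / N * dist x y"
    using lipschitz_bound[of "x / N" "y / N"] assms
    by (simp add: dist_real_def diff_divide_distrib[symmetric])
qed (use L_nonneg assms in simp)

text \<open>
  The constant \<open>l\<close> can be subtracted inside the weighted average because the rescaled weight has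
  integral \<open>N\<close>.  The rescaled weight has Lipschitz constant \<open>L / N\<close> on an interval of length \<open>N\<close>,
  so its variation is at most \<open>L\<close> for every \<open>N\<close>.
\<close>

lemma weighted_average_cont_error:
  fixes a :: "real \<Rightarrow> 'b::banach"
  assumes a: "locally_bochner_integrable a" and "N > 0"
    and K: "\<And>t. t \<in> {0..N} \<Longrightarrow> norm (integral {0..t} (\<lambda>s. a s - l)) \<le> K"
  shows "norm (weighted_average_cont w a N - l) \<le> L * K / N"
proof -
  have aN: "bochner_integrable (lebesgue_on {0..N}) a"
    using a \<open>N > 0\<close> by (simp add: locally_bochner_integrable_def)
  have "bochner_integrable (lebesgue_on {0..N}) (\<lambda>s. w (s / N) *\<^sub>R a s)"
  proof (rule bochner_integrable_scaleR[OF aN])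
    show "(\<lambda>s. w (s / N)) \<in> borel_measurable (lebesgue_on {0..N})"
      using lipschitz_on_continuous_on[OF lipschitz_rescaled[OF \<open>N > 0\<close>]]
      by (intro continuous_imp_measurable_on_sets_lebesgue) auto
    show "\<bar>w (s / N)\<bar> \<le> L" if "s \<in> {0..N}" for s
    proof -
      have "\<bar>w (s / N)\<bar> \<le> L * \<bar>s / N\<bar>" using lipschitz_bound[of "s / N" 0] by simp
      also have "\<dots> \<le> L * 1" using that \<open>N > 0\<close> L_nonneg by (intro mult_left_mono) auto
      finally show ?thesis by simp
    qed
  qed (rule L_nonneg)
  note wa = bochner_integrable_has_integral[OF this]
  note a_int = bochner_integrable_has_integral(1)[OF aN]
  note w_int = has_integral_scaleR_left[OF has_integral_rescaled[OF \<open>N > 0\<close>], of l]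
  have b_int: "(\<lambda>s. a s - l) integrable_on {0..N}"
    using a_int by (intro integrable_diff) auto
  have wb: "((\<lambda>s. w (s / N) *\<^sub>R (a s - l)) has_integral
      integral {0..N} (\<lambda>s. w (s / N) *\<^sub>R a s) - N *\<^sub>R l) {0..N}"
    unfolding scaleR_diff_right using wa(1) w_int
    by (intro has_integral_diff integrable_integral)
  have "norm (integral {0..N} (\<lambda>s. w (s / N) *\<^sub>R (a s - l))) \<le> L / N * (N - 0) * K"
  proof (rule integral_bound_by_variation[where h = "\<lambda>s. norm (a s) + norm l"])
    show "(\<lambda>s. w (s / N) *\<^sub>R (a s - l)) integrable_on {0..N}" using wb by blast
    show "(\<lambda>s. norm (a s) + norm l) integrable_on {0..N}"
      using bochner_integrable_norm(2)[OF aN] by (intro integrable_add) auto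
    show "norm (a s - l) \<le> norm (a s) + norm l" for s by (rule norm_triangle_ineq4)
  qed (use \<open>N > 0\<close> b_int K lipschitz_rescaled in auto)
  moreover have "weighted_average_cont w a N - l
      = (1 / N) *\<^sub>R integral {0..N} (\<lambda>s. w (s / N) *\<^sub>R (a s - l))"
    using \<open>N > 0\<close> unfolding weighted_average_cont_def wa(2) integral_unique[OF wb]
    by (simp add: scaleR_diff_right)
  ultimately show ?thesis using \<open>N > 0\<close> by (simp add: divide_right_mono)
qed

text \<open>
  The primitive \<open>F\<close> of \<open>a - l\<close> is at most \<open>\<eta> t\<close> for \<open>t\<close> beyond some \<open>T\<close>, and it is bounded by a
  constant \<open>C\<close> before.  As soon as \<open>N \<ge> C / \<eta>\<close>, it is at most \<open>2 \<eta> N\<close> on all of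
  \<open>{0..N}\<close>.
\<close>

proposition weighted_average_cont_of_convergent_average:
  fixes a :: "real \<Rightarrow> 'b::banach"
  assumes a: "locally_bochner_integrable a" and lim: "(average_cont a \<longlongrightarrow> l) at_top"
  shows "(weighted_average_cont w a \<longlongrightarrow> l) at_top"
proof (rule tendstoI)
  fix \<epsilon> :: real assume "\<epsilon> > 0"
  \<comment> \<open>The final error will be \<open>2 L \<eta>\<close>; \<open>L + 1\<close> keeps the quotient defined when \<open>L = 0\<close>.\<close>
  define \<eta> where "\<eta> = \<epsilon> / (2 * (L + 1))"
  have \<eta>: "\<eta> > 0" "2 * L * \<eta> < \<epsilon>"
    using \<open>\<epsilon> > 0\<close> L_nonneg by (auto simp: \<eta>_def field_simps)
  have int: "bochner_integrable (lebesgue_on {0..t}) a" if "t \<ge> 0" for t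
    using a that by (simp add: locally_bochner_integrable_def)
  define F where "F t = integral {0..t} (\<lambda>s. a s - l)" for t
  define h where "h s = norm (a s) + norm l" for s
  have b_int: "(\<lambda>s. a s - l) integrable_on {0..t}" and h_int: "h integrable_on {0..t}" if "t \<ge> 0" for t
    using bochner_integrable_has_integral(1)[OF int[OF that]] bochner_integrable_norm(2)[OF int[OF that]]
    unfolding h_def by (auto intro!: integrable_diff integrable_add)
  obtain T0 where T0: "\<And>t. t \<ge> T0 \<Longrightarrow> norm (average_cont a t - l) < \<eta>"
    using tendstoD[OF lim \<eta>(1)] by (auto simp: eventually_at_top_linorder dist_norm)
  define T where "T = max 1 T0"
  have T: "T \<ge> 1" "\<And>t. t \<ge> T \<Longrightarrow> norm (average_cont a t - l) < \<eta>"
    using T0 by (auto simp: T_def)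
  have large: "norm (F t) \<le> \<eta> * t" if "t \<ge> T" for t
  proof -
    have t: "t > 0" using that T(1) by linarith
    note a_t = bochner_integrable_has_integral[OF int[OF less_imp_le[OF t]]]
    have "F t = integral {0..t} a - t *\<^sub>R l"
      unfolding F_def using a_t(1) t by (subst Henstock_Kurzweil_Integration.integral_diff) auto
    also have "\<dots> = t *\<^sub>R (average_cont a t - l)"
      using t by (simp add: average_cont_def a_t(2) scaleR_diff_right)
    finally have "F t = t *\<^sub>R (average_cont a t - l)" .
    then show ?thesis using T(2)[OF that] t by (simp add: mult.commute)
  qed
  define C where "C = integral {0..T} h"
  have small: "norm (F t) \<le> C" if "0 \<le> t" "t \<le> T" for t
  proof -
    have "norm (F t) \<le> integral {0..t} h"
      unfolding F_def using that b_int h_int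
      by (intro Henstock_Kurzweil_Integration.integral_norm_bound_integral)
        (auto simp: h_def norm_triangle_ineq4)
    also have "\<dots> \<le> C"
      unfolding C_def using that T(1) h_int
      by (intro integral_subset_le) (auto simp: h_def)
    finally show ?thesis .
  qed
  have "C \<ge> 0" using small[of 0] T(1) by (simp add: F_def)
  show "\<forall>\<^sub>F N in at_top. dist (weighted_average_cont w a N) l < \<epsilon>"
    using eventually_ge_at_top[of "max T (C / \<eta>)"]
  proof eventually_elim
    case (elim N)
    then have N: "N > 0" "C \<le> \<eta> * N" using T(1) \<eta>(1) by (auto simp: field_simps)
    have "norm (weighted_average_cont w a N - l) \<le> L * (2 * \<eta> * N) / N"
    proof (rule weighted_average_cont_error[OF a N(1)])
      fix t assume t: "t \<in> {0..N}"
      have "\<eta> * t \<le> \<eta> * N" using t \<eta>(1) by (intro mult_left_mono) auto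
      then show "norm (integral {0..t} (\<lambda>s. a s - l)) \<le> 2 * \<eta> * N"
        using small[of t] large[of t] t N(2) \<open>C \<ge> 0\<close> unfolding F_def by (cases "t \<le> T") auto
    qed
    also have "\<dots> = 2 * L * \<eta>" using N(1) by simp
    finally show ?case using \<eta>(2) by (simp add: dist_norm)
  qed
qed

end

section \<open>The weights of the theorem\<close>

text \<open>
  Inside the interval this is the mean value theorem; the bounds by the distance to the end points
  extend the estimate to pairs that contain \<open>0\<close> or \<open>1\<close>.
\<close>

lemma lipschitz_on_vanishing_outside:
  fixes f :: "real \<Rightarrow> real"
  assumes deriv: "\<And>x. 0 < x \<Longrightarrow> x < 1 \<Longrightarrow> (f has_real_derivative f' x) (at x)"
    and bound: "\<And>x. 0 < x \<Longrightarrow> x < 1 \<Longrightarrow> \<bar>f' x\<bar> \<le> L" and "0 \<le> L"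
    and ends: "\<And>x. 0 < x \<Longrightarrow> x < 1 \<Longrightarrow> \<bar>f x\<bar> \<le> L * x"
      "\<And>x. 0 < x \<Longrightarrow> x < 1 \<Longrightarrow> \<bar>f x\<bar> \<le> L * (1 - x)"
    and zero: "\<And>x. x \<notin> {0<..<1} \<Longrightarrow> f x = 0"
  shows "L-lipschitz_on UNIV f"
proof -
  have unit: "\<bar>f x - f y\<bar> \<le> L * (y - x)" if xy: "0 \<le> x" "x \<le> y" "y \<le> 1" for x y
  proof -
    consider "x = y" | "x = 0" "y = 1" | "x = 0" "0 < y" "y < 1" | "y = 1" "0 < x" "x < 1"
      | "0 < x" "x < y" "y < 1"
      using xy by linarith
    then show ?thesis
    proof cases
      case 5
      then obtain z where z: "x < z" "z < y" "f y - f x = (y - x) * f' z"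
        using MVT2[of x y f f'] deriv by force
      then have "\<bar>f x - f y\<bar> = (y - x) * \<bar>f' z\<bar>"
        using 5 by (simp add: abs_minus_commute[of "f x"] abs_mult)
      also have "\<dots> \<le> (y - x) * L"
        using 5 z bound[of z] by (intro mult_left_mono) auto
      finally show ?thesis by (simp add: mult.commute)
    qed (use ends zero[of 0] zero[of 1] \<open>0 \<le> L\<close> in auto)
  qed
  \<comment> \<open>Projecting to the unit interval leaves the values of \<open>f\<close> alone and does not increase distances.\<close>
  define c :: "real \<Rightarrow> real" where "c x = max 0 (min 1 x)" for x
  have c: "f (c x) = f x" "0 \<le> c x" "c x \<le> 1" for x
    using zero[of 0] zero[of 1] zero[of x] by (auto simp: c_def max_def min_def)
  have le: "\<bar>f x - f y\<bar> \<le> L * \<bar>x - y\<bar>" if "x \<le> y" for x y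
  proof -
    have "c x \<le> c y" "c y - c x \<le> y - x" using that by (auto simp: c_def)
    then have "\<bar>f x - f y\<bar> \<le> L * (c y - c x)" using unit[of "c x" "c y"] c by simp
    also have "\<dots> \<le> L * (y - x)"
      using \<open>c y - c x \<le> y - x\<close> \<open>0 \<le> L\<close> by (rule mult_left_mono)
    finally show ?thesis using that by simp
  qed
  show ?thesis
  proof (rule lipschitz_onI)
    fix x y
    show "dist (f x) (f y) \<le> L * dist x y"
      using le[of x y] le[of y x] unfolding dist_real_def
      by (cases "x \<le> y") (simp_all add: abs_minus_commute)
  qed (rule \<open>0 \<le> L\<close>)
qed

text \<open>
  The power \<open>\<alpha>\<close> of the inequality \<open>t / \<alpha> \<le> exp (t / \<alpha>)\<close>.
\<close>

lemma powr_le_exp: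
  fixes t \<alpha> :: real
  assumes "t > 0" "\<alpha> > 0"
  shows "t powr \<alpha> * exp (- t) \<le> \<alpha> powr \<alpha>"
proof -
  have "t / \<alpha> \<le> exp (t / \<alpha>)" using exp_ge_add_one_self[of "t / \<alpha>"] by linarith
  then have "(t / \<alpha>) powr \<alpha> \<le> exp (t / \<alpha>) powr \<alpha>"
    using assms by (intro powr_mono2) auto
  also have "\<dots> = exp t" using assms by (simp add: powr_def)
  finally have "t powr \<alpha> / \<alpha> powr \<alpha> \<le> exp t" using assms by (simp add: powr_divide)
  then show ?thesis using assms by (simp add: exp_minus field_simps)
qed

definition bump_exponent :: "real \<Rightarrow> real \<Rightarrow> real \<Rightarrow> real" where
  "bump_exponent p q x = x powr (-p) * (1 - x) powr (-q)"

lemma bump_exponent_reflect: "bump_exponent p q x = bump_exponent q p (1 - x)"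
  by (simp add: bump_exponent_def mult.commute)

lemma bump_exponent_pos: "0 < x \<Longrightarrow> x < 1 \<Longrightarrow> 0 < bump_exponent p q x"
  by (simp add: bump_exponent_def)

text \<open>
  Near the end point \<open>0\<close> the singular factor \<open>1 / x\<close> of the derivative is itself controlled by a
  power of the exponent, because the other factor \<open>(1 - x) powr (-q)\<close> is at least \<open>1\<close>.
\<close>

lemma inverse_le_bump_exponent_powr:
  assumes "0 < p" "0 < q" "0 < x" "x < 1"
  shows "1 / x \<le> bump_exponent p q x powr (1 / p)"
proof -
  have "1 \<le> (1 - x) powr (-q)"
    using assms powr_mono_both'[of "-q" 0 "1 - x" 1] by (simp add: powr_minus powr_le1 one_le_inverse)
  then have "x powr (-p) * 1 \<le> bump_exponent p q x"
    unfolding bump_exponent_def by (intro mult_left_mono) auto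
  then have "(x powr (-p)) powr (1 / p) \<le> bump_exponent p q x powr (1 / p)"
    using assms by (intro powr_mono2) auto
  moreover have "(x powr (-p)) powr (1 / p) = 1 / x"
    using assms unfolding powr_powr by (simp add: powr_minus_divide)
  ultimately show ?thesis by simp
qed

lemma bump_exponent_deriv:
  assumes "0 < x" "x < 1"
  shows "(bump_exponent p q has_real_derivative
    bump_exponent p q x * (q / (1 - x) - p / x)) (at x)"
  unfolding bump_exponent_def[abs_def] using assms
  by (auto intro!: derivative_eq_intros simp: powr_diff field_simps)

text \<open>
  The function \<open>w_pq p q\<close> before normalisation.
\<close>

definition bump :: "real \<Rightarrow> real \<Rightarrow> real \<Rightarrow> real" where
  "bump p q x = (if x \<in> {0<..<1} then exp (- bump_exponent p q x) else 0)"

text \<open>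
  The case \<open>\<alpha> = 0\<close> bounds the bump itself by a multiple of \<open>x\<close>; the case \<open>\<alpha> = 1\<close> bounds a term of
  its derivative.  The end point \<open>1\<close> is reached through reflection.
\<close>

lemma bump_over_boundary_distance:
  assumes "0 < p" "0 < q" "0 < x" "x < 1" "0 \<le> \<alpha>"
  shows "bump_exponent p q x powr \<alpha> * exp (- bump_exponent p q x) * (1 / x)
    \<le> (\<alpha> + 1 / p) powr (\<alpha> + 1 / p)"
proof -
  let ?g = "bump_exponent p q x"
  have g: "?g > 0" using assms by (simp add: bump_exponent_pos)
  have "?g powr \<alpha> * exp (- ?g) * (1 / x) \<le> ?g powr \<alpha> * exp (- ?g) * ?g powr (1 / p)"
    using inverse_le_bump_exponent_powr[of p q x] assms by (intro mult_left_mono) auto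
  also have "\<dots> = ?g powr (\<alpha> + 1 / p) * exp (- ?g)" by (simp add: powr_add mult_ac)
  also have "\<dots> \<le> (\<alpha> + 1 / p) powr (\<alpha> + 1 / p)"
    using g assms by (intro powr_le_exp add_nonneg_pos) auto
  finally show ?thesis .
qed

lemma bump_lipschitz:
  assumes "0 < p" "0 < q"
  shows "\<exists>L. L-lipschitz_on UNIV (bump p q)"
proof
  \<comment> \<open>\<open>A\<close> collects the bounds by the distance to the end points, \<open>B\<close> those on the two terms of the derivative.\<close>
  define A where "A p = (1 / p) powr (1 / p)" for p :: real
  define B where "B p = p * (1 + 1 / p) powr (1 + 1 / p)" for p :: real
  define L where "L = A p + A q + B p + B q"
  let ?g = "bump_exponent p q"
  have nonneg: "0 \<le> A p" "0 \<le> A q" "0 \<le> B p" "0 \<le> B q"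
    using assms by (auto simp: A_def B_def)
  have A: "exp (- bump_exponent r s x) \<le> A r * x" if "0 < x" "x < 1" "0 < r" "0 < s" for r s x
    using bump_over_boundary_distance[of r s x 0] that bump_exponent_pos[of x r s]
    by (simp add: A_def field_simps)
  have B: "r * (bump_exponent r s x * exp (- bump_exponent r s x) / x) \<le> B r"
    if "0 < x" "x < 1" "0 < r" "0 < s" for r s x
  proof -
    have "bump_exponent r s x * exp (- bump_exponent r s x) / x \<le> (1 + 1 / r) powr (1 + 1 / r)"
      using bump_over_boundary_distance[of r s x 1] that bump_exponent_pos[of x r s] by simp
    then show ?thesis unfolding B_def using that by (intro mult_left_mono) auto
  qed
  show "L-lipschitz_on UNIV (bump p q)"
  proof (rule lipschitz_on_vanishing_outside)
    fix x :: real assume x: "0 < x" "x < 1"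
    have "((\<lambda>x. exp (- ?g x)) has_real_derivative
        exp (- ?g x) * - (?g x * (q / (1 - x) - p / x))) (at x)"
      by (rule derivative_eq_intros bump_exponent_deriv[OF x] refl)+
    then show "(bump p q has_real_derivative exp (- ?g x) * - (?g x * (q / (1 - x) - p / x))) (at x)"
      by (rule has_field_derivative_transform_within_open[where S = "{0<..<1}"])
        (use x in \<open>auto simp: bump_def\<close>)
    have "exp (- ?g x) * - (?g x * (q / (1 - x) - p / x))
        = p * (?g x * exp (- ?g x) / x) - q * (?g x * exp (- ?g x) / (1 - x))"
      by (simp add: algebra_simps)
    moreover have "0 \<le> p * (?g x * exp (- ?g x) / x)" "0 \<le> q * (?g x * exp (- ?g x) / (1 - x))"
      using assms x bump_exponent_pos[OF x, of p q] by auto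
    moreover have "p * (?g x * exp (- ?g x) / x) \<le> B p" "q * (?g x * exp (- ?g x) / (1 - x)) \<le> B q"
      using B[of x p q] B[of "1 - x" q p] assms x bump_exponent_reflect[of p q x] by auto
    ultimately show "\<bar>exp (- ?g x) * - (?g x * (q / (1 - x) - p / x))\<bar> \<le> L"
      using nonneg unfolding L_def by linarith
    have "bump p q x \<le> A p * x" "bump p q x \<le> A q * (1 - x)"
      using A[of x p q] A[of "1 - x" q p] assms x bump_exponent_reflect[of p q x]
      by (auto simp: bump_def)
    moreover have "A p * x \<le> L * x" "A q * (1 - x) \<le> L * (1 - x)"
      using nonneg x by (auto simp: L_def intro!: mult_right_mono)
    moreover have "\<bar>bump p q x\<bar> = bump p q x" by (simp add: bump_def)
    ultimately show "\<bar>bump p q x\<bar> \<le> L * x" "\<bar>bump p q x\<bar> \<le> L * (1 - x)"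
      by linarith+
  qed (use nonneg in \<open>auto simp: L_def bump_def\<close>)
qed

lemma has_integral_interval_lborel:
  fixes f :: "real \<Rightarrow> real"
  assumes "continuous_on {0..1} f"
  shows "(f has_integral (LBINT x:{0..1}. f x)) {0..1}"
    and "(LBINT x:{0<..<1}. f x) = (LBINT x:{0..1}. f x)"
proof -
  have int: "set_integrable lborel {0..1} f"
    using borel_integrable_atLeastAtMost'[OF assms] .
  then have int': "set_integrable lborel {0<..<1} f"
    by (rule set_integrable_subset) auto
  show "(f has_integral (LBINT x:{0..1}. f x)) {0..1}"
    using set_borel_integral_eq_integral[OF int] by (simp add: has_integral_iff)
  show "(LBINT x:{0<..<1}. f x) = (LBINT x:{0..1}. f x)"
    unfolding set_borel_integral_eq_integral(2)[OF int] set_borel_integral_eq_integral(2)[OF int']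
    by (rule integral_open_interval_real[symmetric])
qed

proposition w_pq_lipschitz_weight:
  assumes "0 < p" "0 < q"
  shows "\<exists>L. lipschitz_weight (w_pq p q) L"
proof -
  obtain L where L: "L-lipschitz_on UNIV (bump p q)"
    using bump_lipschitz[OF assms] by blast
  then have cont: "continuous_on {0..1} (bump p q)"
    using lipschitz_on_continuous_on continuous_on_subset by blast
  define I where "I = (LBINT x:{0..1}. bump p q x)"
  have I: "(bump p q has_integral I) {0..1}"
    unfolding I_def by (rule has_integral_interval_lborel(1)[OF cont])
  have "bump p q (1/2) \<noteq> 0" by (simp add: bump_def)
  moreover have "integral {0..1} (bump p q) = 0 \<longleftrightarrow> (\<forall>x\<in>{0..1}. bump p q x = 0)"
    by (rule integral_eq_0_iff[OF cont]) (auto simp: bump_def)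
  ultimately have "I \<noteq> 0" using integral_unique[OF I] by auto
  have "(LBINT s:{0<..<1}. exp (- (s powr (-p) * (1 - s) powr (-q)))) = (LBINT s:{0<..<1}. bump p q s)"
    by (rule set_lebesgue_integral_cong) (auto simp: bump_def bump_exponent_def)
  then have w: "w_pq p q = (\<lambda>x. inverse I * bump p q x)"
    using has_integral_interval_lborel(2)[OF cont]
    by (auto simp: fun_eq_iff w_pq_def bump_def bump_exponent_def I_def)
  have "lipschitz_weight (w_pq p q) (\<bar>inverse I\<bar> * L)"
  proof
    show "(\<bar>inverse I\<bar> * L)-lipschitz_on UNIV (w_pq p q)"
      unfolding w using lipschitz_on_cmult_real[OF L, of "inverse I"] by simp
    show "w_pq p q x = 0" if "x \<notin> {0<..<1}" for x
      using that by (auto simp: w_pq_def)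
    show "(w_pq p q has_integral 1) {0..1}"
      unfolding w using has_integral_mult_right[OF I, of "inverse I"] \<open>I \<noteq> 0\<close> by simp
  qed
  then show ?thesis by blast
qed

text \<open>
  The derivative is bounded on the compact unit interval, and continuity forces the weight to
  vanish at the end points.
\<close>

proposition C01_lipschitz_weight:
  assumes w: "w \<in> C01" and one: "(LBINT x:{0..1}. w x) = 1"
  shows "\<exists>L. lipschitz_weight w L"
proof -
  have outside: "w x = 0" if "x \<notin> {0..1}" for x
    using w that unfolding C01_def by blast
  obtain D where D: "\<And>x. (w has_vector_derivative D x) (at x)" and D_cont: "continuous_on UNIV D"
    using w unfolding C01_def C1_differentiable_on_def by auto
  then have deriv: "(w has_real_derivative D x) (at x)" for x
    by (simp add: has_real_derivative_iff_has_vector_derivative)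
  have cont: "continuous_on A w" for A
    using deriv by (intro continuous_at_imp_continuous_on) (auto intro: DERIV_isCont)
  have "w 0 = 0"
  proof (rule tendsto_unique[of "at_left 0"])
    show "(w \<longlongrightarrow> w 0) (at_left 0)"
      using DERIV_isCont[OF deriv] filterlim_at_split by (auto simp: isCont_def)
    have "\<forall>\<^sub>F x in at_left (0::real). 0 = w x"
      by (auto intro!: eventually_mono[OF eventually_at_left_real[of "-1"]] simp: outside)
    then show "(w \<longlongrightarrow> 0) (at_left 0)" by (rule Lim_transform_eventually[OF tendsto_const])
  qed simp
  moreover have "w 1 = 0"
  proof (rule tendsto_unique[of "at_right 1"])
    show "(w \<longlongrightarrow> w 1) (at_right 1)"
      using DERIV_isCont[OF deriv] filterlim_at_split by (auto simp: isCont_def)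
    have "\<forall>\<^sub>F x in at_right (1::real). 0 = w x"
      by (auto intro!: eventually_mono[OF eventually_at_right_real[of 1 2]] simp: outside)
    then show "(w \<longlongrightarrow> 0) (at_right 1)" by (rule Lim_transform_eventually[OF tendsto_const])
  qed simp
  ultimately have zero: "w x = 0" if "x \<notin> {0<..<1}" for x
    using that outside[of x] by (cases "x = 0 \<or> x = 1") auto
  have "compact (D ` {0..1})"
    using continuous_on_subset[OF D_cont] by (intro compact_continuous_image) auto
  then obtain L where L: "\<And>x. x \<in> {0..1} \<Longrightarrow> \<bar>D x\<bar> \<le> L"
    using compact_imp_bounded[of "D ` {0..1}"] unfolding bounded_iff ball_simps real_norm_def by blast
  have mvt: "\<bar>w y - w x\<bar> \<le> L * (y - x)" if "0 \<le> x" "x < y" "y \<le> 1" for x y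
  proof -
    obtain z where z: "x < z" "z < y" "w y - w x = (y - x) * D z"
      using MVT2[OF \<open>x < y\<close>, of w D] deriv by blast
    then have "\<bar>w y - w x\<bar> = (y - x) * \<bar>D z\<bar>" using that by (simp add: abs_mult)
    also have "\<dots> \<le> (y - x) * L" using that z L[of z] by (intro mult_left_mono) auto
    finally show ?thesis by (simp add: mult.commute)
  qed
  have "L-lipschitz_on UNIV w"
  proof (rule lipschitz_on_vanishing_outside[OF deriv _ _ _ _ zero])
    show "0 \<le> L" using L[of 0] by (simp add: order_trans[OF abs_ge_zero])
    show "\<bar>w x\<bar> \<le> L * x" "\<bar>w x\<bar> \<le> L * (1 - x)" if "0 < x" "x < 1" for x
      using mvt[of 0 x] mvt[of x 1] that zero[of 0] zero[of 1] by auto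
  qed (use L in auto)
  then have "lipschitz_weight w L"
    using zero has_integral_interval_lborel(1)[OF cont] one by unfold_locales auto
  then show ?thesis ..
qed

section \<open>The averaging theorem\<close>

theorem theorem1p1:
  fixes p q :: real
  assumes "p > 0" and "q > 0"
  shows
    "(\<forall>(a :: nat \<Rightarrow> 'b::banach) l.
        average a \<longlonglongrightarrow> l \<longrightarrow> weighted_average (w_pq p q) a \<longlonglongrightarrow> l) \<and>
     (\<forall>(a :: real \<Rightarrow> 'b) l.
        locally_bochner_integrable a \<longrightarrow>
        (average_cont a \<longlongrightarrow> l) at_top \<longrightarrow>
        (weighted_average_cont (w_pq p q) a \<longlongrightarrow> l) at_top) \<and>
     (\<exists>(a :: nat \<Rightarrow> real) l.
        weighted_average (w_pq p q) a \<longlonglongrightarrow> l \<and> \<not> average a \<longlonglongrightarrow> l) \<and>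
     (\<forall>w\<in>C01. (LBINT x:{0..1}. w x) = 1 \<longrightarrow>
        (\<forall>(a :: nat \<Rightarrow> 'b) l.
           average a \<longlonglongrightarrow> l \<longrightarrow> weighted_average w a \<longlonglongrightarrow> l) \<and>
        (\<forall>(a :: real \<Rightarrow> 'b) l.
           locally_bochner_integrable a \<longrightarrow>
           (average_cont a \<longlongrightarrow> l) at_top \<longrightarrow>
           (weighted_average_cont w a \<longlongrightarrow> l) at_top) \<and>
        (\<exists>(a :: nat \<Rightarrow> real) l.
           weighted_average w a \<longlonglongrightarrow> l \<and> \<not> average a \<longlonglongrightarrow> l))"
proof -
  have averaging: "(\<forall>(a :: nat \<Rightarrow> 'b) l.
        average a \<longlonglongrightarrow> l \<longrightarrow> weighted_average w a \<longlonglongrightarrow> l) \<and>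
      (\<forall>(a :: real \<Rightarrow> 'b) l.
        locally_bochner_integrable a \<longrightarrow>
        (average_cont a \<longlongrightarrow> l) at_top \<longrightarrow>
        (weighted_average_cont w a \<longlongrightarrow> l) at_top) \<and>
      (\<exists>(a :: nat \<Rightarrow> real) l.
        weighted_average w a \<longlonglongrightarrow> l \<and> \<not> average a \<longlonglongrightarrow> l)"
    if ex: "\<exists>L. lipschitz_weight w L" for w
  proof -
    obtain L where "lipschitz_weight w L" using ex ..
    then interpret lipschitz_weight w L .
    show ?thesis
      using weighted_average_of_convergent_average weighted_average_cont_of_convergent_average
        weighted_average_converse_fails by blast
  qed
  have C01: "\<exists>L. lipschitz_weight w L" if "w \<in> C01" "(LBINT x:{0..1}. w x) = 1" for w
    using that by (rule C01_lipschitz_weight)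
  show ?thesis
    using averaging[OF w_pq_lipschitz_weight[OF assms]] averaging[OF C01] by simp
qed

end
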